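(* There are absolute constants $0<c_1\le c_2$ and an absolute constant $\kappa>0$ such that the following holds. For every $n$ and $\delta\in(0,1)$ there is a distribution over linear maps $\mathbf S:\mathbb R^n\to\mathbb R^m$ with $m=O(\log^4 n+\log^2(1/\delta)\log n)$ such that for every $x\in\mathbb R^n$: $\|\mathbf Sx\|_1\le c_2\|x\|_1$ with probability at least $\kappa$, and $\|\mathbf Sx\|_1\ge c_1\|x\|_1$ with probability at least $1-\delta$. Moreover, when $n=k^2$, $\mathbf S$ can be applied to a rank-one tensor $a\otimes b$ with $a,b\in\mathbb R^k$ in $O(mk)$ time, and when $n=k^3$, $\mathbf S$ can be applied to a rank-one tensor $a\otimes b\otimes c$ with $a,b,c\in\mathbb R^k$ in $O(mk\log^2 k)$ time.
   Context: $\otimes$ denotes the Kronecker product; a rank-one tensor in $\mathbb R^k\otimes\mathbb R^k$ (resp. $\mathbb R^k\otimes\mathbb R^k\otimes\mathbb R^k$) is identified with a vector in $\mathbb R^{k^2}$ (resp. $\mathbb R^{k^3}$). *)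

theory Defs
  imports
    "HOL-Probability.Probability"
    "Jordan_Normal_Form.Matrix"
begin

definition l1_norm_vec :: "real vec \<Rightarrow> real" where
  "l1_norm_vec v = (\<Sum>i<dim_vec v. \<bar>v $ i\<bar>)"

(* Lexicographic indexing: the entry at position i * dim_vec b + j is a_i * b_j. *)
definition kron_vec :: "real vec \<Rightarrow> real vec \<Rightarrow> real vec" where
  "kron_vec a b =
     vec (dim_vec a * dim_vec b) (\<lambda>i. a $ (i div dim_vec b) * b $ (i mod dim_vec b))"

(* A distribution over linear maps from R^n to R^m, a linear map being given by its m x n matrix.
   The sigma-algebra is only required to make the entries measurable, i.e. to contain the Borel
   sets of R^(m x n); this makes every event about S *v x that is used below measurable. *)
definition linear_map_distribution :: "nat \<Rightarrow> nat \<Rightarrow> real mat measure \<Rightarrow> bool" where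
  "linear_map_distribution m n M \<longleftrightarrow>
     prob_space M \<and> space M = carrier_mat m n \<and>
     (\<forall>i<m. \<forall>j<n. (\<lambda>S. S $$ (i, j)) \<in> borel_measurable M)"

text \<open>
  Running time is the number of arithmetic operations over the reals, in the standard model of
  straight-line programs. There are no comparisons, no rounding and no integer operations on real
  values, so every program is also a unit-cost real RAM computation with the same number of steps
  up to a constant. The registers initially hold the input; each instruction costs one
  step and appends its result as a new register.
\<close>

datatype slp_instr = Const real | Add nat nat | Sub nat nat | Mul nat nat

fun slp_operands :: "slp_instr \<Rightarrow> nat set" where
  "slp_operands (Const c) = {}"
| "slp_operands (Add i j) = {i, j}"
| "slp_operands (Sub i j) = {i, j}"
| "slp_operands (Mul i j) = {i, j}"

fun slp_value :: "slp_instr \<Rightarrow> real list \<Rightarrow> real" where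
  "slp_value (Const c) rs = c"
| "slp_value (Add i j) rs = rs ! i + rs ! j"
| "slp_value (Sub i j) rs = rs ! i - rs ! j"
| "slp_value (Mul i j) rs = rs ! i * rs ! j"

fun slp_run :: "slp_instr list \<Rightarrow> real list \<Rightarrow> real list" where
  "slp_run [] rs = rs"
| "slp_run (c # p) rs = slp_run p (rs @ [slp_value c rs])"

(* Started on N registers, instruction number t may only read the N + t registers that exist when
   it is executed. The list outs names the registers that hold the output. *)
definition slp_wf :: "nat \<Rightarrow> slp_instr list \<Rightarrow> nat list \<Rightarrow> bool" where
  "slp_wf N p outs \<longleftrightarrow>
     (\<forall>t<length p. slp_operands (p ! t) \<subseteq> {..<N + t}) \<and> set outs \<subseteq> {..<N + length p}"

definition slp_output :: "slp_instr list \<Rightarrow> nat list \<Rightarrow> real list \<Rightarrow> real vec" where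
  "slp_output p outs inp = vec_of_list (map (\<lambda>r. slp_run p inp ! r) outs)"

(* The matrix S is fixed before the tensor is given, so the program may depend on S (it is the
   stored form of S, and all its constants and addresses are charged for), but the same program
   must work for all factors; the input is the list of factors, not the expanded tensor. *)
definition applies_to_rank_one2_within :: "real mat \<Rightarrow> nat \<Rightarrow> real \<Rightarrow> bool" where
  "applies_to_rank_one2_within S k T \<longleftrightarrow>
     (\<exists>p outs. real (length p) \<le> T \<and> slp_wf (2 * k) p outs \<and>
       (\<forall>a\<in>carrier_vec k. \<forall>b\<in>carrier_vec k.
          slp_output p outs (list_of_vec a @ list_of_vec b) = S *\<^sub>v kron_vec a b))"

definition applies_to_rank_one3_within :: "real mat \<Rightarrow> nat \<Rightarrow> real \<Rightarrow> bool" where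
  "applies_to_rank_one3_within S k T \<longleftrightarrow>
     (\<exists>p outs. real (length p) \<le> T \<and> slp_wf (3 * k) p outs \<and>
       (\<forall>a\<in>carrier_vec k. \<forall>b\<in>carrier_vec k. \<forall>c\<in>carrier_vec k.
          slp_output p outs (list_of_vec a @ list_of_vec b @ list_of_vec c) =
          S *\<^sub>v kron_vec (kron_vec a b) c))"

end

theory Submission
  imports Defs
begin

text \<open>
  The rows of \<open>S\<close> are independent and identically distributed, and each row \<open>r\<close> behaves like a
  Cauchy vector on every fixed \<open>x\<close>: \<open>P (\<bar>r \<bullet> x\<bar> > t)\<close> is of order \<open>\<parallel>x\<parallel> / t\<close> in the relevant range of
  \<open>t\<close>. For \<open>m = 4 ^ g\<close> such variables, truncated means are of order \<open>g \<parallel>x\<parallel>\<close>, so that after division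
  by \<open>m g\<close> the norm is at most \<open>c\<^sub>2 \<parallel>x\<parallel>\<close> with constant probability (Markov), and at least
  \<open>c\<^sub>1 \<parallel>x\<parallel>\<close> except with probability \<open>exp (- \<Omega> (g 2 ^ g))\<close> (Chernoff, at exponent \<open>1 / (2 ^ g \<parallel>x\<parallel>)\<close>).
  Hence \<open>m = O (1 + ln (1 / \<delta>)\<^sup>2)\<close> rows suffice, independently of \<open>n\<close>.

  To make a row cheap on rank-one tensors, write it as \<open>w (T \<otimes> \<dots> \<otimes> T)\<close>, where \<open>w\<close> has independent
  heavy-tailed entries and each \<open>T\<close> is a random map from dimension \<open>q\<close> to \<open>O (q ^ (1/4))\<close> with one
  nonzero entry per column. The only properties needed from \<open>T\<close> are \<open>E \<parallel>T x\<parallel> \<le> \<parallel>x\<parallel>\<close> and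
  \<open>E (min \<parallel>T x\<parallel> \<parallel>x\<parallel>) \<ge> c \<parallel>x\<parallel>\<close>; both are inherited by compositions and by Kronecker products.
\<close>

section \<open>Expectations over finitely supported distributions\<close>

text \<open>The same \<open>T\<close> serves all fibres of the tensor, so the coordinates of a
  sketched vector are strongly dependent and \<parallel>T x\<parallel> need not concentrate. Two
  expectations suffice because heavy-tailed weights turn expectations into tails: for a fixed
  \<open>y\<close>, P(\<bar>w \<bullet> y\<bar> > t) is comparable to \<parallel>y\<parallel> / t,
  which is linear in \<parallel>y\<parallel>. Averaging over the random \<open>y = T x\<close>
  therefore needs the mean of \<parallel>y\<parallel> from above and, since a probability saturates
  once \<parallel>y\<parallel> exceeds t, a truncated mean from below. Fluctuations of \<parallel>T
  x\<parallel> disappear among those that a Cauchy-like variable has anyway, and the independence of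
  the rows does the rest.

  The exponent 1/4 is dictated by cost. Once three factors are sketched to dimension D, a row still
  acts on a core of D^3 entries, which must not exceed order k. Square roots would leave k^(3/2);
  any exponent up to 1/3 would do, and 1/4 is two square-root steps.\<close>

abbreviation expect :: "'a pmf \<Rightarrow> ('a \<Rightarrow> real) \<Rightarrow> real" where
  "expect p f \<equiv> measure_pmf.expectation p f"

lemma expect_mono:
  assumes "finite (set_pmf p)" "\<And>x. x \<in> set_pmf p \<Longrightarrow> f x \<le> g x"
  shows "expect p f \<le> expect p g"
  using assms by (intro integral_mono_AE integrable_measure_pmf_finite) (auto simp: AE_measure_pmf_iff)

lemma expect_add:
  assumes "finite (set_pmf p)"
  shows "expect p (\<lambda>x. f x + g x) = expect p f + expect p g"
  using assms by (intro Bochner_Integration.integral_add integrable_measure_pmf_finite)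

lemma expect_sum:
  assumes "finite (set_pmf p)"
  shows "expect p (\<lambda>x. \<Sum>i\<in>I. f i x) = (\<Sum>i\<in>I. expect p (f i))"
  using assms by (intro Bochner_Integration.integral_sum integrable_measure_pmf_finite)

lemma expect_bind:
  assumes "finite (set_pmf p)" "\<And>x. x \<in> set_pmf p \<Longrightarrow> finite (set_pmf (f x))"
  shows "expect (bind_pmf p f) g = expect p (\<lambda>x. expect (f x) g)"
proof -
  have "expect (bind_pmf p f) g = (\<Sum>a\<in>set_pmf p. pmf p a *\<^sub>R expect (f a) g)"
    using assms by (intro pmf_expectation_bind) auto
  also have "\<dots> = expect p (\<lambda>x. expect (f x) g)"
    using assms by (subst integral_measure_pmf[of "set_pmf p"]) auto
  finally show ?thesis .
qed

lemma expect_cong: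
  assumes "\<And>x. x \<in> set_pmf p \<Longrightarrow> f x = g x"
  shows "expect p f = expect p g"
  using assms by (intro integral_cong_AE) (auto simp: AE_measure_pmf_iff)

lemma prob_eq_expect: "measure_pmf.prob p {x. P x} = expect p (\<lambda>x. of_bool (P x))"
proof -
  have "measure_pmf.prob p {x. P x} = expect p (indicator {x. P x})" by simp
  also have "\<dots> = expect p (\<lambda>x. of_bool (P x))" by (intro expect_cong) (auto simp: indicator_def)
  finally show ?thesis .
qed

lemma finite_set_Pi_pmf:
  assumes "finite A" "\<And>x. x \<in> A \<Longrightarrow> finite (set_pmf (p x))"
  shows "finite (set_pmf (Pi_pmf A d p))"
  using assms by (subst set_Pi_pmf) auto

lemma finite_set_bind_pmf:
  assumes "finite (set_pmf p)" "\<And>x. x \<in> set_pmf p \<Longrightarrow> finite (set_pmf (f x))"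
  shows "finite (set_pmf (bind_pmf p f))"
  using assms by (auto simp: set_bind_pmf)

lemma expect_Pi_pmf_insert:
  assumes "finite A" "a \<notin> A" "\<And>x. x \<in> insert a A \<Longrightarrow> finite (set_pmf (p x))"
  shows "expect (Pi_pmf (insert a A) d p) g
         = expect (p a) (\<lambda>y. expect (Pi_pmf A d p) (\<lambda>f. g (f(a := y))))"
proof -
  have "Pi_pmf (insert a A) d p = bind_pmf (p a) (\<lambda>y. map_pmf (\<lambda>f. f(a := y)) (Pi_pmf A d p))"
    using assms by (simp add: Pi_pmf_insert' map_pmf_def)
  then show ?thesis using assms
    by (simp add: expect_bind finite_set_Pi_pmf)
qed

lemma expect_commute:
  assumes "finite (set_pmf p)" "finite (set_pmf q)"
  shows "expect p (\<lambda>x. expect q (\<lambda>y. f x y)) = expect q (\<lambda>y. expect p (\<lambda>x. f x y))"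
  by (simp add: integral_measure_pmf[of "set_pmf p"] integral_measure_pmf[of "set_pmf q"] assms
        sum_distrib_left mult.left_commute sum.swap[of _ "set_pmf q"])

text \<open>For averaging over one sign or one hash value with all others frozen. Both sides average
  over a value at \<open>a\<close> and over the remaining coordinates; the value that is overwritten
  on the right does not matter.\<close>

lemma expect_Pi_pmf_resample:
  assumes "finite A" "a \<in> A" "\<And>x. x \<in> A \<Longrightarrow> finite (set_pmf (p x))"
  shows "expect (Pi_pmf A d p) g
         = expect (Pi_pmf A d p) (\<lambda>f. expect (p a) (\<lambda>y. g (f(a := y))))"
proof -
  have A: "A = insert a (A - {a})" using assms by auto
  have fin: "finite (set_pmf (Pi_pmf (A - {a}) d p))" "finite (set_pmf (p a))"
    using assms by (auto intro!: finite_set_Pi_pmf)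
  have E: "expect (Pi_pmf A d p) h
        = expect (p a) (\<lambda>y. expect (Pi_pmf (A - {a}) d p) (\<lambda>f. h (f(a := y))))" for h
    by (subst A, subst expect_Pi_pmf_insert) (use assms in auto)
  show ?thesis
    unfolding E using fin by (simp add: expect_commute[of "p a"])
qed

lemma expect_Pi_pmf_component:
  assumes "finite A" "a \<in> A"
  shows "expect (Pi_pmf A d p) (\<lambda>f. g (f a)) = expect (p a) g"
proof -
  have "expect (p a) g = expect (map_pmf (\<lambda>f. f a) (Pi_pmf A d p)) g"
    using assms by (simp add: Pi_pmf_component)
  then show ?thesis by simp
qed

definition random_sign :: "real pmf" where
  "random_sign = map_pmf (\<lambda>b. if b then 1 else -1) (bernoulli_pmf (1/2))"

lemma expect_random_sign: "expect random_sign f = (f 1 + f (-1)) / 2"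
  by (simp add: random_sign_def)

lemma set_random_sign: "set_pmf random_sign \<subseteq> {1, -1}"
  by (auto simp: random_sign_def)

lemma finite_set_random_sign [simp]: "finite (set_pmf random_sign)"
  using set_random_sign finite_subset by blast

section \<open>Maps with one nonzero entry per column\<close>

text \<open>A pair \<open>(h, c)\<close> stands for the matrix whose column \<open>i\<close> has the entry \<open>c i\<close> in row \<open>h i\<close>
  and zeros elsewhere.\<close>

type_synonym sketch = "(nat \<Rightarrow> nat) \<times> (nat \<Rightarrow> real)"

definition l1 :: "nat \<Rightarrow> (nat \<Rightarrow> real) \<Rightarrow> real" where
  "l1 n x = (\<Sum>i<n. \<bar>x i\<bar>)"

definition sk_apply :: "nat \<Rightarrow> sketch \<Rightarrow> (nat \<Rightarrow> real) \<Rightarrow> nat \<Rightarrow> real" where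
  "sk_apply n T x v = (\<Sum>i | i < n \<and> fst T i = v. snd T i * x i)"

definition sk_into :: "nat \<Rightarrow> nat \<Rightarrow> sketch \<Rightarrow> bool" where
  "sk_into n d T \<longleftrightarrow> (\<forall>i<n. fst T i < d)"

lemma l1_nonneg [simp]: "0 \<le> l1 n x"
  by (simp add: l1_def sum_nonneg)

lemma sum_fibres:
  fixes g :: "nat \<Rightarrow> 'a :: comm_monoid_add" and d :: nat
  assumes "\<And>i. i < n \<Longrightarrow> h i < d"
  shows "(\<Sum>v<d. \<Sum>i | i < n \<and> h i = v. g i) = (\<Sum>i<n. g i)"
proof -
  have "(\<Sum>v<d. sum g {i \<in> {..<n}. h i = v}) = sum g {..<n}"
    using assms by (intro sum.group) auto
  then show ?thesis by simp
qed

lemma sum_eq_of_bool: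
  fixes f :: "nat \<Rightarrow> real"
  shows "(\<Sum>i | i < n \<and> P i. f i) = (\<Sum>i<n. of_bool (P i) * f i)"
  by (rule sum.mono_neutral_cong_left) auto

lemma l1_sk_apply_le:
  assumes "sk_into n d T"
  shows "l1 d (sk_apply n T x) \<le> (\<Sum>i<n. \<bar>snd T i\<bar> * \<bar>x i\<bar>)"
proof -
  have "l1 d (sk_apply n T x) \<le> (\<Sum>v<d. \<Sum>i | i < n \<and> fst T i = v. \<bar>snd T i\<bar> * \<bar>x i\<bar>)"
    unfolding l1_def sk_apply_def
    by (intro sum_mono order_trans[OF sum_abs]) (simp add: abs_mult)
  also have "\<dots> = (\<Sum>i<n. \<bar>snd T i\<bar> * \<bar>x i\<bar>)"
    using assms by (intro sum_fibres) (auto simp: sk_into_def)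
  finally show ?thesis .
qed

text \<open>The upper condition is placed on columns, that is on unit vectors, because in this form
  it multiplies under composition and Kronecker products; the triangle inequality extends it to all
  \<open>x\<close>. The cap \<open>l1 n x\<close> keeps the lower condition from being met by rare
  huge outcomes, since those barely raise a tail probability.\<close>

definition l1_sketch :: "nat \<Rightarrow> nat \<Rightarrow> real \<Rightarrow> sketch pmf \<Rightarrow> bool" where
  "l1_sketch n d c p \<longleftrightarrow> finite (set_pmf p) \<and> (\<forall>T\<in>set_pmf p. sk_into n d T) \<and>
     (\<forall>i<n. expect p (\<lambda>T. \<bar>snd T i\<bar>) \<le> 1) \<and>
     (\<forall>x. c * l1 n x \<le> expect p (\<lambda>T. min (l1 d (sk_apply n T x)) (l1 n x)))"

lemma l1_sketchD:
  assumes "l1_sketch n d c p"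
  shows "finite (set_pmf p)" "\<And>T. T \<in> set_pmf p \<Longrightarrow> sk_into n d T"
    "\<And>i. i < n \<Longrightarrow> expect p (\<lambda>T. \<bar>snd T i\<bar>) \<le> 1"
    "\<And>x. c * l1 n x \<le> expect p (\<lambda>T. min (l1 d (sk_apply n T x)) (l1 n x))"
  using assms by (auto simp: l1_sketch_def)

lemma l1_sketch_expect_le:
  assumes "l1_sketch n d c p"
  shows "expect p (\<lambda>T. l1 d (sk_apply n T x)) \<le> l1 n x"
proof -
  note p = l1_sketchD[OF assms]
  have "expect p (\<lambda>T. l1 d (sk_apply n T x)) \<le> expect p (\<lambda>T. \<Sum>i<n. \<bar>snd T i\<bar> * \<bar>x i\<bar>)"
    using p by (intro expect_mono l1_sk_apply_le) auto
  also have "\<dots> = (\<Sum>i<n. expect p (\<lambda>T. \<bar>snd T i\<bar>) * \<bar>x i\<bar>)"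
    using p(1) by (simp add: expect_sum)
  also have "\<dots> \<le> (\<Sum>i<n. 1 * \<bar>x i\<bar>)"
    using p(3) by (intro sum_mono mult_right_mono) auto
  finally show ?thesis by (simp add: l1_def)
qed

text \<open>Truncating at \<open>Y\<close> or at \<open>X\<close> costs no more than the factor \<open>min 1 (X/Y)\<close>; this is what lets
  the truncated lower bounds be chained through an intermediate norm \<open>Y\<close>.\<close>

lemma expect_min_chain:
  assumes fin: "finite (set_pmf p)" and "\<And>T. T \<in> set_pmf p \<Longrightarrow> 0 \<le> f T" and "0 \<le> Y" "0 \<le> X"
    and le: "c * Y \<le> expect p (\<lambda>T. min (f T) Y)"
  shows "c * min Y X \<le> expect p (\<lambda>T. min (f T) X)"
proof (cases "Y \<le> X")
  case True
  have "expect p (\<lambda>T. min (f T) Y) \<le> expect p (\<lambda>T. min (f T) X)"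
    using fin True by (intro expect_mono) auto
  then show ?thesis using le True by (simp add: min_absorb1)
next
  case False
  have Y: "0 < Y" using False assms by linarith
  have "c * X = X / Y * (c * Y)" using Y by simp
  also have "\<dots> \<le> X / Y * expect p (\<lambda>T. min (f T) Y)"
    using le Y \<open>0 \<le> X\<close> by (intro mult_left_mono) auto
  also have "\<dots> = expect p (\<lambda>T. X / Y * min (f T) Y)" by simp
  also have "\<dots> \<le> expect p (\<lambda>T. min (f T) X)"
  proof (intro expect_mono fin)
    fix T assume T: "T \<in> set_pmf p"
    have "X / Y \<le> 1" "0 \<le> X / Y" using False Y \<open>0 \<le> X\<close> by auto
    have "X / Y * min (f T) Y \<le> 1 * f T"
      using assms(2)[OF T] \<open>0 \<le> X / Y\<close> \<open>X / Y \<le> 1\<close> Y by (intro mult_mono) auto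
    moreover have "X / Y * min (f T) Y \<le> X / Y * Y"
      using \<open>0 \<le> X / Y\<close> by (intro mult_left_mono) auto
    ultimately show "X / Y * min (f T) Y \<le> min (f T) X" using Y by simp
  qed
  finally show ?thesis using False by (simp add: min_absorb2)
qed

section \<open>Composition of sketches\<close>

definition sk_comp :: "sketch \<Rightarrow> sketch \<Rightarrow> sketch" where
  "sk_comp U T = (\<lambda>i. fst U (fst T i), \<lambda>i. snd U (fst T i) * snd T i)"

lemma sk_apply_comp:
  assumes "sk_into n e T"
  shows "sk_apply n (sk_comp U T) x = sk_apply e U (sk_apply n T x)"
proof
  fix v
  have "sk_apply e U (sk_apply n T x) v
      = (\<Sum>u<e. \<Sum>i | i < n \<and> fst T i = u. of_bool (fst U (fst T i) = v) * (snd U (fst T i) * snd T i * x i))"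
    unfolding sk_apply_def[of e] sum_eq_of_bool[of _ e]
    by (intro sum.cong refl) (simp add: sk_apply_def sum_distrib_left mult.assoc)
  also have "\<dots> = (\<Sum>i<n. of_bool (fst U (fst T i) = v) * (snd U (fst T i) * snd T i * x i))"
    using assms by (intro sum_fibres) (auto simp: sk_into_def)
  also have "\<dots> = sk_apply n (sk_comp U T) x v"
    unfolding sk_apply_def sk_comp_def sum_eq_of_bool by simp
  finally show "sk_apply n (sk_comp U T) x v = sk_apply e U (sk_apply n T x) v" ..
qed

text \<open>With \<open>Y\<close> the norm of \<open>sk_apply n T x\<close>, the guarantee of
  \<open>q\<close> applies to that vector with cap \<open>Y\<close>, and
  \<open>expect_min_chain\<close> exchanges the cap for \<open>l1 n x\<close>. As \<open>U\<close>
  is drawn independently of \<open>T\<close>, this works for each \<open>T\<close>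
  separately.\<close>

lemma l1_sketch_comp:
  assumes p: "l1_sketch n e c p" and q: "l1_sketch e d c' q" and "0 \<le> c'"
  shows "l1_sketch n d (c' * c) (bind_pmf p (\<lambda>T. map_pmf (\<lambda>U. sk_comp U T) q))"
  unfolding l1_sketch_def
proof (intro conjI ballI allI impI)
  note pD = l1_sketchD[OF p] and qD = l1_sketchD[OF q]
  let ?r = "bind_pmf p (\<lambda>T. map_pmf (\<lambda>U. sk_comp U T) q)"
  show "finite (set_pmf ?r)" using pD qD by (intro finite_set_bind_pmf) auto
  show "sk_into n d V" if "V \<in> set_pmf ?r" for V
    using that pD(2) qD(2) by (auto simp: sk_into_def sk_comp_def set_bind_pmf)
  have E: "expect ?r g = expect p (\<lambda>T. expect q (\<lambda>U. g (sk_comp U T)))" for g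
    using pD qD by (simp add: expect_bind)
  show "expect ?r (\<lambda>V. \<bar>snd V i\<bar>) \<le> 1" if i: "i < n" for i
  proof -
    have "expect ?r (\<lambda>V. \<bar>snd V i\<bar>) = expect p (\<lambda>T. expect q (\<lambda>U. \<bar>snd U (fst T i)\<bar>) * \<bar>snd T i\<bar>)"
      unfolding E by (simp add: sk_comp_def abs_mult)
    also have "\<dots> \<le> expect p (\<lambda>T. 1 * \<bar>snd T i\<bar>)"
      using pD(1,2) qD(3) i by (intro expect_mono mult_right_mono) (auto simp: sk_into_def)
    also have "\<dots> \<le> 1" using pD(3) i by simp
    finally show ?thesis .
  qed
  show "c' * c * l1 n x \<le> expect ?r (\<lambda>V. min (l1 d (sk_apply n V x)) (l1 n x))" for x
  proof -
    have "c' * c * l1 n x \<le> c' * expect p (\<lambda>T. min (l1 e (sk_apply n T x)) (l1 n x))"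
      using pD(4)[of x] \<open>0 \<le> c'\<close> by (simp add: mult.assoc mult_left_mono)
    also have "\<dots> = expect p (\<lambda>T. c' * min (l1 e (sk_apply n T x)) (l1 n x))" by simp
    also have "\<dots> \<le> expect p (\<lambda>T. expect q (\<lambda>U. min (l1 d (sk_apply e U (sk_apply n T x))) (l1 n x)))"
      using qD pD by (intro expect_mono expect_min_chain) auto
    also have "\<dots> = expect ?r (\<lambda>V. min (l1 d (sk_apply n V x)) (l1 n x))"
      unfolding E by (intro expect_cong) (simp add: sk_apply_comp[OF pD(2)])
    finally show ?thesis .
  qed
qed

section \<open>Kronecker products of sketches\<close>

definition sk_kron :: "nat \<Rightarrow> nat \<Rightarrow> sketch \<Rightarrow> sketch \<Rightarrow> sketch" where
  "sk_kron n' d' T T' =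
     (\<lambda>i. fst T (i div n') * d' + fst T' (i mod n'), \<lambda>i. snd T (i div n') * snd T' (i mod n'))"

lemma sum_lessThan_mult:
  fixes f :: "nat \<Rightarrow> 'a :: comm_monoid_add"
  shows "(\<Sum>i<n * n'. f i) = (\<Sum>i<n. \<Sum>j<n'. f (i * n' + j))"
proof (cases "n' = 0")
  case False
  have "(\<Sum>i<n. \<Sum>j<n'. f (i * n' + j)) = (\<Sum>(i, j)\<in>{..<n} \<times> {..<n'}. f (i * n' + j))"
    by (simp add: sum.cartesian_product)
  also have "\<dots> = (\<Sum>i<n * n'. f i)"
  proof (rule sum.reindex_bij_witness[of _ "\<lambda>i. (i div n', i mod n')" "\<lambda>(i, j). i * n' + j"])
    fix i assume "i \<in> {..<n * n'}"
    then show "(i div n', i mod n') \<in> {..<n} \<times> {..<n'}"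
      using False by (simp add: less_mult_imp_div_less)
  next
    fix a assume "a \<in> {..<n} \<times> {..<n'}"
    then obtain i j where a: "a = (i, j)" "i < n" "j < n'" by auto
    have "i * n' + j < (i + 1) * n'" using a by simp
    also have "\<dots> \<le> n * n'" using a by (intro mult_right_mono) auto
    finally show "(case a of (i, j) \<Rightarrow> i * n' + j) \<in> {..<n * n'}" using a by simp
  qed auto
  finally show ?thesis ..
qed auto

lemma sk_into_kron:
  assumes "sk_into n d T" "sk_into n' d' T'"
  shows "sk_into (n * n') (d * d') (sk_kron n' d' T T')"
  unfolding sk_into_def
proof (intro allI impI)
  fix i assume i: "i < n * n'"
  then have n': "0 < n'" by (cases n') auto
  have "fst T (i div n') + 1 \<le> d" "fst T' (i mod n') < d'"
    using assms i n' by (auto simp: sk_into_def less_mult_imp_div_less Suc_le_eq)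
  then have "fst T (i div n') * d' + fst T' (i mod n') < (fst T (i div n') + 1) * d'" by simp
  also have "\<dots> \<le> d * d'" using \<open>fst T (i div n') + 1 \<le> d\<close> by (rule mult_right_mono) simp
  finally show "fst (sk_kron n' d' T T') i < d * d'" by (simp add: sk_kron_def)
qed

lemma mult_add_eq_iff:
  fixes a b u v d :: nat
  assumes "b < d" "v < d"
  shows "a * d + b = u * d + v \<longleftrightarrow> a = u \<and> b = v"
proof
  assume eq: "a * d + b = u * d + v"
  have "(a * d + b) div d = a" "(u * d + v) div d = u" using assms by auto
  then have "a = u" using eq by simp
  then show "a = u \<and> b = v" using eq by simp
qed auto

lemma sk_apply_kron:
  assumes "sk_into n' d' T'" "v' < d'"
  shows "sk_apply (n * n') (sk_kron n' d' T T') x (v * d' + v')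
         = sk_apply n T (\<lambda>i. sk_apply n' T' (\<lambda>j. x (i * n' + j)) v') v"
proof -
  have "sk_apply (n * n') (sk_kron n' d' T T') x (v * d' + v')
     = (\<Sum>i<n. \<Sum>j<n'. of_bool (fst T i = v) * (of_bool (fst T' j = v') *
         (snd T i * snd T' j * x (i * n' + j))))"
    unfolding sk_apply_def sum_eq_of_bool sum_lessThan_mult sk_kron_def
    using assms by (intro sum.cong refl) (auto simp: mult_add_eq_iff sk_into_def)
  also have "\<dots> = sk_apply n T (\<lambda>i. sk_apply n' T' (\<lambda>j. x (i * n' + j)) v') v"
    unfolding sk_apply_def sum_eq_of_bool by (simp add: sum_distrib_left mult_ac)
  finally show ?thesis .
qed

text \<open>Read \<open>x\<close> as an \<open>n\<close> by \<open>n'\<close> array: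
  \<open>T'\<close> sketches every row, then \<open>T\<close> sketches every column of the resulting
  \<open>n\<close> by \<open>d'\<close> array. That all rows share \<open>T'\<close> and all columns
  share \<open>T\<close> is harmless, since only expectations of sums are estimated. A sum of
  truncated norms is at most the truncation of the sum, so the bounds for single rows and columns
  add up.\<close>

lemma l1_sketch_kron:
  assumes p: "l1_sketch n d c p" and q: "l1_sketch n' d' c' q" and "0 \<le> c"
  shows "l1_sketch (n * n') (d * d') (c * c') (bind_pmf q (\<lambda>T'. map_pmf (\<lambda>T. sk_kron n' d' T T') p))"
  unfolding l1_sketch_def
proof (intro conjI ballI allI impI)
  note pD = l1_sketchD[OF p] and qD = l1_sketchD[OF q]
  let ?r = "bind_pmf q (\<lambda>T'. map_pmf (\<lambda>T. sk_kron n' d' T T') p)"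
  show "finite (set_pmf ?r)" using pD qD by (intro finite_set_bind_pmf) auto
  show "sk_into (n * n') (d * d') V" if "V \<in> set_pmf ?r" for V
    using that pD(2) qD(2) by (auto simp: set_bind_pmf intro!: sk_into_kron)
  have E: "expect ?r g = expect q (\<lambda>T'. expect p (\<lambda>T. g (sk_kron n' d' T T')))" for g
    using pD qD by (simp add: expect_bind)
  show "expect ?r (\<lambda>V. \<bar>snd V i\<bar>) \<le> 1" if i: "i < n * n'" for i
  proof -
    have "0 < n'" using i by (cases n') auto
    then have *: "i div n' < n" "i mod n' < n'" using i by (auto simp: less_mult_imp_div_less)
    have "expect ?r (\<lambda>V. \<bar>snd V i\<bar>)
        = expect p (\<lambda>T. \<bar>snd T (i div n')\<bar>) * expect q (\<lambda>T. \<bar>snd T (i mod n')\<bar>)"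
      unfolding E by (simp add: sk_kron_def abs_mult)
    also have "\<dots> \<le> 1 * 1"
      using pD(3) qD(3) * by (intro mult_mono) auto
    finally show ?thesis by simp
  qed
  fix x
  define y where "y T' v' i = sk_apply n' T' (\<lambda>j. x (i * n' + j)) v'" for T' v' i
  have X: "l1 (n * n') x = (\<Sum>i<n. l1 n' (\<lambda>j. x (i * n' + j)))"
    by (simp add: l1_def sum_lessThan_mult)
  \<comment> \<open>The mass of the intermediate array, counted by columns on the left and by rows
    on the right, links the two stages.\<close>
  have Y: "(\<Sum>v'<d'. l1 n (y T' v')) = (\<Sum>i<n. l1 d' (sk_apply n' T' (\<lambda>j. x (i * n' + j))))" for T'
    unfolding l1_def y_def by (rule sum.swap)
  have Z: "l1 (d * d') (sk_apply (n * n') (sk_kron n' d' T T') x) = (\<Sum>v'<d'. l1 d (sk_apply n T (y T' v')))"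
    if "T' \<in> set_pmf q" for T T'
    unfolding l1_def sum_lessThan_mult y_def sum.swap[of _ "{..<d'}"]
    using qD(2)[OF that] by (simp add: sk_apply_kron)
  have "c * c' * l1 (n * n') x = c * (\<Sum>i<n. c' * l1 n' (\<lambda>j. x (i * n' + j)))"
    unfolding X by (simp add: sum_distrib_left mult.assoc)
  also have "\<dots> \<le> c * (\<Sum>i<n. expect q (\<lambda>T'. min (l1 d' (sk_apply n' T' (\<lambda>j. x (i * n' + j)))) (l1 n' (\<lambda>j. x (i * n' + j)))))"
    using \<open>0 \<le> c\<close> qD(4) by (intro mult_left_mono sum_mono) auto
  also have "\<dots> = c * expect q (\<lambda>T'. \<Sum>i<n. min (l1 d' (sk_apply n' T' (\<lambda>j. x (i * n' + j)))) (l1 n' (\<lambda>j. x (i * n' + j))))"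
    using qD(1) by (simp add: expect_sum)
  also have "\<dots> \<le> c * expect q (\<lambda>T'. min (\<Sum>v'<d'. l1 n (y T' v')) (l1 (n * n') x))"
    unfolding X Y using \<open>0 \<le> c\<close> qD(1)
    by (intro mult_left_mono expect_mono) (auto intro!: sum_mono)
  also have "\<dots> = expect q (\<lambda>T'. c * min (\<Sum>v'<d'. l1 n (y T' v')) (l1 (n * n') x))" by simp
  also have "\<dots> \<le> expect q (\<lambda>T'. expect p (\<lambda>T. min (\<Sum>v'<d'. l1 d (sk_apply n T (y T' v'))) (l1 (n * n') x)))"
  proof (intro expect_mono qD(1) expect_min_chain pD(1))
    fix T'
    have "c * (\<Sum>v'<d'. l1 n (y T' v')) \<le> (\<Sum>v'<d'. expect p (\<lambda>T. min (l1 d (sk_apply n T (y T' v'))) (l1 n (y T' v'))))"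
      unfolding sum_distrib_left by (intro sum_mono pD(4))
    also have "\<dots> = expect p (\<lambda>T. \<Sum>v'<d'. min (l1 d (sk_apply n T (y T' v'))) (l1 n (y T' v')))"
      using pD(1) by (simp add: expect_sum)
    also have "\<dots> \<le> expect p (\<lambda>T. min (\<Sum>v'<d'. l1 d (sk_apply n T (y T' v'))) (\<Sum>v'<d'. l1 n (y T' v')))"
      using pD(1) by (intro expect_mono) (auto intro!: sum_mono)
    finally show "c * (\<Sum>v'<d'. l1 n (y T' v')) \<le> \<dots>" .
  qed (auto intro!: sum_nonneg)
  also have "\<dots> = expect ?r (\<lambda>V. min (l1 (d * d') (sk_apply (n * n') V x)) (l1 (n * n') x))"
    unfolding E by (intro expect_cong) (simp add: Z)
  finally show "c * c' * l1 (n * n') x \<le> expect ?r (\<lambda>V. min (l1 (d * d') (sk_apply (n * n') V x)) (l1 (n * n') x))" .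
qed

section \<open>Straight-line programs\<close>

lemma slp_run_append: "slp_run (p @ q) rs = slp_run q (slp_run p rs)"
  by (induction p arbitrary: rs) auto

lemma length_slp_run [simp]: "length (slp_run p rs) = length rs + length p"
  by (induction p arbitrary: rs) auto

text \<open>Register addresses are hidden behind the set of functions of the input that are
  available after at most \<open>t\<close> instructions, so programs can be assembled without
  bookkeeping. Outputs are chosen only at the very end, hence the empty list in
  \<open>slp_wf\<close>.\<close>

definition slp_computes :: "nat \<Rightarrow> nat \<Rightarrow> (real list \<Rightarrow> real) set \<Rightarrow> bool" where
  "slp_computes N t F \<longleftrightarrow> (\<exists>p. length p \<le> t \<and> slp_wf N p [] \<and>
     (\<forall>f\<in>F. \<exists>r<N + length p. \<forall>inp. length inp = N \<longrightarrow> slp_run p inp ! r = f inp))"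

lemma slp_computes_inputs: "slp_computes N 0 ((\<lambda>i inp. inp ! i) ` {..<N})"
  unfolding slp_computes_def slp_wf_def by (intro exI[of _ "[]"]) auto

lemma slp_computes_mono:
  "slp_computes N t F \<Longrightarrow> t \<le> t' \<Longrightarrow> F' \<subseteq> F \<Longrightarrow> slp_computes N t' F'"
  unfolding slp_computes_def by (meson order_trans subsetD)

lemma slp_computes_step:
  assumes p: "length p \<le> t" "slp_wf N p []"
    and F: "\<forall>f\<in>F. \<exists>r<N + length p. \<forall>inp. length inp = N \<longrightarrow> slp_run p inp ! r = f inp"
    and c: "slp_operands c \<subseteq> {..<N + length p}"
    and g: "\<And>inp. length inp = N \<Longrightarrow> slp_value c (slp_run p inp) = g inp"
  shows "slp_computes N (t + 1) (insert g F)"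
  unfolding slp_computes_def
proof (intro exI[of _ "p @ [c]"] conjI ballI)
  show "slp_wf N (p @ [c]) []"
    using p c by (auto simp: slp_wf_def nth_append less_Suc_eq subset_iff)
  fix f assume "f \<in> insert g F"
  then consider "f = g" | "f \<in> F" by auto
  then show "\<exists>r<N + length (p @ [c]). \<forall>inp. length inp = N \<longrightarrow> slp_run (p @ [c]) inp ! r = f inp"
  proof cases
    case 1
    then show ?thesis using g
      by (intro exI[of _ "N + length p"]) (auto simp: slp_run_append nth_append)
  next
    case 2
    then obtain r where r: "r < N + length p" "\<forall>inp. length inp = N \<longrightarrow> slp_run p inp ! r = f inp"
      using F by blast
    then show ?thesis
      by (intro exI[of _ r]) (auto simp: slp_run_append nth_append)
  qed
qed (use p in auto)

lemma slp_computes_const: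
  assumes "slp_computes N t F"
  shows "slp_computes N (t + 1) (insert (\<lambda>_. c) F)"
proof -
  obtain p where p: "length p \<le> t" "slp_wf N p []"
    "\<forall>f\<in>F. \<exists>r<N + length p. \<forall>inp. length inp = N \<longrightarrow> slp_run p inp ! r = f inp"
    using assms unfolding slp_computes_def by blast
  show ?thesis by (rule slp_computes_step[OF p, of "Const c"]) auto
qed

lemma slp_computes_add_mult:
  assumes "slp_computes N t F" "f \<in> F" "g \<in> F"
  shows "slp_computes N (t + 1) (insert (\<lambda>x. f x + g x) F)"
    and "slp_computes N (t + 1) (insert (\<lambda>x. f x * g x) F)"
proof -
  obtain p where p: "length p \<le> t" "slp_wf N p []"
    "\<forall>f\<in>F. \<exists>r<N + length p. \<forall>inp. length inp = N \<longrightarrow> slp_run p inp ! r = f inp"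
    using assms unfolding slp_computes_def by blast
  obtain r s where r: "r < N + length p" "\<And>inp. length inp = N \<Longrightarrow> slp_run p inp ! r = f inp"
    and s: "s < N + length p" "\<And>inp. length inp = N \<Longrightarrow> slp_run p inp ! s = g inp"
    using p(3) assms(2,3) by metis
  show "slp_computes N (t + 1) (insert (\<lambda>x. f x + g x) F)"
    by (rule slp_computes_step[OF p, of "Add r s"]) (use r s in auto)
  show "slp_computes N (t + 1) (insert (\<lambda>x. f x * g x) F)"
    by (rule slp_computes_step[OF p, of "Mul r s"]) (use r s in auto)
qed

text \<open>A program fragment usable in any context: \<open>F'\<close> is whatever is already
  available, it must contain \<open>F\<close>, and nothing in it is lost. This lets independent
  fragments share earlier results.\<close>

definition slp_extends :: "nat \<Rightarrow> nat \<Rightarrow> (real list \<Rightarrow> real) set \<Rightarrow> (real list \<Rightarrow> real) set \<Rightarrow> bool" where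
  "slp_extends N t F G \<longleftrightarrow> (\<forall>s F'. F \<subseteq> F' \<longrightarrow> slp_computes N s F' \<longrightarrow> slp_computes N (s + t) (F' \<union> G))"

lemma slp_extends_UN:
  assumes "finite I" "\<And>i. i \<in> I \<Longrightarrow> slp_extends N (t i) F (G i)"
  shows "slp_extends N (\<Sum>i\<in>I. t i) F (\<Union>i\<in>I. G i)"
  using assms
proof (induction I rule: finite_induct)
  case empty
  show ?case by (simp add: slp_extends_def)
next
  case (insert i I)
  show ?case unfolding slp_extends_def
  proof (intro allI impI)
    fix s F' assume F': "F \<subseteq> F'" "slp_computes N s F'"
    have "slp_computes N (s + sum t I) (F' \<union> (\<Union>i\<in>I. G i))"
      using insert F' by (simp add: slp_extends_def)
    moreover have "F \<subseteq> F' \<union> (\<Union>i\<in>I. G i)" using F' by auto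
    ultimately have "slp_computes N (s + sum t I + t i) (F' \<union> (\<Union>i\<in>I. G i) \<union> G i)"
      using insert.prems[of i] unfolding slp_extends_def by blast
    then show "slp_computes N (s + sum t (insert i I)) (F' \<union> (\<Union>i\<in>insert i I. G i))"
      using insert.hyps by (simp add: ac_simps Un_assoc)
  qed
qed

lemma slp_extends_trans:
  assumes "slp_extends N t F G" "slp_extends N t' (F \<union> G) H"
  shows "slp_extends N (t + t') F (G \<union> H)"
  unfolding slp_extends_def
proof (intro allI impI)
  fix s F' assume F': "F \<subseteq> F'" "slp_computes N s F'"
  then have "slp_computes N (s + t) (F' \<union> G)" using assms(1) by (simp add: slp_extends_def)
  moreover have "F \<union> G \<subseteq> F' \<union> G" using F' by auto
  ultimately have "slp_computes N (s + t + t') (F' \<union> G \<union> H)"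
    using assms(2) unfolding slp_extends_def by blast
  then show "slp_computes N (s + (t + t')) (F' \<union> (G \<union> H))" by (simp add: ac_simps Un_assoc)
qed

lemma slp_extends_mono:
  assumes "slp_extends N t F G" "t \<le> t'" "F \<subseteq> F'" "G' \<subseteq> G"
  shows "slp_extends N t' F' G'"
  unfolding slp_extends_def
proof (intro allI impI)
  fix s F'' assume "F' \<subseteq> F''" "slp_computes N s F''"
  then have "slp_computes N (s + t) (F'' \<union> G)"
    using assms(1,3) unfolding slp_extends_def by blast
  then show "slp_computes N (s + t') (F'' \<union> G')"
    by (rule slp_computes_mono) (use assms in auto)
qed

lemma slp_extends_mult:
  assumes "f \<in> F" "g \<in> F"
  shows "slp_extends N 1 F {\<lambda>x. f x * g x}"
  unfolding slp_extends_def using assms slp_computes_add_mult(2) by fastforce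

text \<open>Each term takes three instructions, namely loading the coefficient, multiplying and
  adding; the extra one loads the initial zero.\<close>

lemma slp_extends_lincomb:
  assumes "finite I" "\<And>i. i \<in> I \<Longrightarrow> f i \<in> F"
  shows "slp_extends N (3 * card I + 1) F {\<lambda>x. \<Sum>i\<in>I. c i * f i x}"
  using assms
proof (induction I rule: finite_induct)
  case empty
  then show ?case using slp_computes_const[where c = 0] by (simp add: slp_extends_def)
next
  case (insert i I)
  show ?case unfolding slp_extends_def
  proof (intro allI impI)
    fix s F' assume F': "F \<subseteq> F'" "slp_computes N s F'"
    define S where "S = (\<lambda>x. \<Sum>i\<in>I. c i * f i x)"
    have "slp_computes N (s + (3 * card I + 1)) (insert S F')"
      using insert F' unfolding slp_extends_def S_def by auto
    from slp_computes_const[OF this, of "c i"]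
    have 1: "slp_computes N (s + (3 * card I + 1) + 1) (insert (\<lambda>_. c i) (insert S F'))" .
    have 2: "slp_computes N (s + (3 * card I + 1) + 1 + 1)
        (insert (\<lambda>x. c i * f i x) (insert (\<lambda>_. c i) (insert S F')))"
      by (rule slp_computes_add_mult(2)[OF 1]) (use insert F' in auto)
    have 3: "slp_computes N (s + (3 * card I + 1) + 1 + 1 + 1)
        (insert (\<lambda>x. c i * f i x + S x) (insert (\<lambda>x. c i * f i x) (insert (\<lambda>_. c i) (insert S F'))))"
      by (rule slp_computes_add_mult(1)[OF 2]) auto
    have "(\<lambda>x. c i * f i x + S x) = (\<lambda>x. \<Sum>i\<in>insert i I. c i * f i x)"
      using insert.hyps by (simp add: S_def)
    then show "slp_computes N (s + (3 * card (insert i I) + 1)) (F' \<union> {\<lambda>x. \<Sum>i\<in>insert i I. c i * f i x})"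
      using insert.hyps by (intro slp_computes_mono[OF 3]) auto
  qed
qed

text \<open>The fibres of \<open>fst T\<close> partition the inputs, so the \<open>D\<close> linear
  combinations have \<open>k\<close> terms in total. This linear cost is the benefit of one nonzero
  entry per column.\<close>

lemma slp_extends_sk_apply:
  assumes "sk_into k D T" "\<And>j. j < k \<Longrightarrow> x j \<in> F"
  shows "slp_extends N (3 * k + D) F ((\<lambda>u inp. sk_apply k T (\<lambda>j. x j inp) u) ` {..<D})"
proof -
  have "slp_extends N (\<Sum>u<D. 3 * card {j. j < k \<and> fst T j = u} + 1) F
      (\<Union>u<D. {\<lambda>inp. \<Sum>j | j < k \<and> fst T j = u. snd T j * x j inp})"
    using assms by (intro slp_extends_UN slp_extends_lincomb) auto
  moreover have "(\<Sum>u<D. card {j. j < k \<and> fst T j = u}) = k"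
    using sum_fibres[of k "fst T" D "\<lambda>_. 1 :: nat"] assms by (simp add: sk_into_def)
  then have "(\<Sum>u<D. 3 * card {j. j < k \<and> fst T j = u} + 1) = 3 * k + D"
    by (simp only: sum.distrib sum_distrib_left[symmetric]) simp
  ultimately show ?thesis
    unfolding sk_apply_def by (auto simp: UNION_singleton_eq_range)
qed

lemma slp_extends_products:
  assumes "\<And>u. u < n \<Longrightarrow> f u \<in> F" "\<And>v. v < n' \<Longrightarrow> g v \<in> F"
  shows "slp_extends N (n * n') F ((\<lambda>(u, v) x. f u x * g v x) ` ({..<n} \<times> {..<n'}))"
proof -
  have "slp_extends N (\<Sum>i\<in>{..<n} \<times> {..<n'}. 1) F
      (\<Union>i\<in>{..<n} \<times> {..<n'}. {\<lambda>x. f (fst i) x * g (snd i) x})"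
    using assms by (intro slp_extends_UN slp_extends_mult) auto
  then show ?thesis by (simp add: UNION_singleton_eq_range case_prod_unfold)
qed

section \<open>Applying a structured row to a rank-one tensor\<close>

definition sk_row :: "sketch \<Rightarrow> (nat \<Rightarrow> real) \<Rightarrow> nat \<Rightarrow> real" where
  "sk_row V w j = snd V j * w (fst V j)"

lemma sum_sk_row:
  assumes "sk_into n d V"
  shows "(\<Sum>j<n. sk_row V w j * x j) = (\<Sum>v<d. w v * sk_apply n V x v)"
proof -
  have "(\<Sum>v<d. w v * sk_apply n V x v) = (\<Sum>v<d. \<Sum>j | j < n \<and> fst V j = v. sk_row V w j * x j)"
    unfolding sk_apply_def sk_row_def by (simp add: sum_distrib_left mult_ac)
  also have "\<dots> = (\<Sum>j<n. sk_row V w j * x j)"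
    using assms by (intro sum_fibres) (auto simp: sk_into_def)
  finally show ?thesis ..
qed

text \<open>The mixed-product rule for Kronecker products. It allows the factors to be sketched
  separately, so the tensor of dimension \<open>n * n'\<close> is never formed.\<close>

lemma sk_apply_kron_tensor:
  assumes "sk_into n' d' T'" "v' < d'"
  shows "sk_apply (n * n') (sk_kron n' d' T T') (\<lambda>i. a (i div n') * b (i mod n')) (v * d' + v')
         = sk_apply n T a v * sk_apply n' T' b v'"
proof -
  have "sk_apply (n * n') (sk_kron n' d' T T') (\<lambda>i. a (i div n') * b (i mod n')) (v * d' + v')
      = sk_apply n T (\<lambda>i. sk_apply n' T' (\<lambda>j. a i * b j) v') v"
    unfolding sk_apply_kron[OF assms] unfolding sk_apply_def
    by (intro sum.cong refl arg_cong[where f = "(*) _"]) auto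
  also have "\<dots> = sk_apply n T a v * sk_apply n' T' b v'"
    unfolding sk_apply_def sum_product by (simp add: sum_distrib_left mult_ac)
  finally show ?thesis .
qed

lemma sk_apply_cong:
  "(\<And>i. i < n \<Longrightarrow> x i = y i) \<Longrightarrow> sk_apply n T x v = sk_apply n T y v"
  unfolding sk_apply_def by (intro sum.cong) auto

lemma row_kron2:
  assumes T: "sk_into k D T1" "sk_into k D T2"
  shows "(\<Sum>j<k * k. sk_row (sk_kron k D T1 T2) w j * (a (j div k) * b (j mod k)))
       = (\<Sum>(u, v)\<in>{..<D} \<times> {..<D}. w (u * D + v) * (sk_apply k T1 a u * sk_apply k T2 b v))"
  unfolding sum_sk_row[OF sk_into_kron[OF T]] unfolding sum_lessThan_mult
  by (simp add: sk_apply_kron_tensor[OF T(2)] sum.cartesian_product[symmetric])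

lemma row_kron3:
  assumes T: "sk_into k D T1" "sk_into k D T2" "sk_into k D T3"
  shows "(\<Sum>j<k * k * k. sk_row (sk_kron k D (sk_kron k D T1 T2) T3) w j
            * (a (j div k div k) * b (j div k mod k) * c (j mod k)))
       = (\<Sum>((u, v), z)\<in>({..<D} \<times> {..<D}) \<times> {..<D}. w ((u * D + v) * D + z) *
            (sk_apply k T1 a u * sk_apply k T2 b v * sk_apply k T3 c z))"
proof -
  have "(\<Sum>j<k * k * k. sk_row (sk_kron k D (sk_kron k D T1 T2) T3) w j
            * ((\<lambda>i. a (i div k) * b (i mod k)) (j div k) * c (j mod k)))
      = (\<Sum>u<D. \<Sum>v<D. \<Sum>z<D. w ((u * D + v) * D + z) *
            (sk_apply k T1 a u * sk_apply k T2 b v * sk_apply k T3 c z))"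
    unfolding sum_sk_row[OF sk_into_kron[OF sk_into_kron[OF T(1,2)] T(3)]]
    unfolding sum_lessThan_mult
    by (intro sum.cong refl)
       (simp add: sk_apply_kron_tensor[OF T(3), where a = "\<lambda>i. a (i div k) * b (i mod k)"]
          sk_apply_kron_tensor[OF T(2)])
  then show ?thesis
    by (simp add: sum.cartesian_product' case_prod_unfold)
qed

lemma slp_realises:
  assumes "slp_extends N t ((\<lambda>i inp. inp ! i) ` {..<N}) (f ` {..<m})"
  obtains p outs where "length p \<le> t" "slp_wf N p outs"
    "\<And>inp. length inp = N \<Longrightarrow> slp_output p outs inp = vec m (\<lambda>i. f i inp)"
proof -
  have "slp_computes N (0 + t) ((\<lambda>i inp. inp ! i) ` {..<N} \<union> f ` {..<m})"
    using assms slp_computes_inputs unfolding slp_extends_def by blast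
  then obtain p where p: "length p \<le> t" "slp_wf N p []"
    and ex: "\<forall>g \<in> (\<lambda>i inp. inp ! i) ` {..<N} \<union> f ` {..<m}.
      \<exists>r<N + length p. \<forall>inp. length inp = N \<longrightarrow> slp_run p inp ! r = g inp"
    unfolding slp_computes_def by auto
  have "\<forall>i\<in>{..<m}. \<exists>r. r < N + length p \<and> (\<forall>inp. length inp = N \<longrightarrow> slp_run p inp ! r = f i inp)"
    using ex by blast
  then obtain r where r: "\<And>i. i < m \<Longrightarrow> r i < N + length p"
    "\<And>i inp. i < m \<Longrightarrow> length inp = N \<Longrightarrow> slp_run p inp ! r i = f i inp"
    by (metis lessThan_iff)
  show thesis
  proof (rule that[of p "map r [0..<m]"])
    show "slp_wf N p (map r [0..<m])" using p r(1) by (auto simp: slp_wf_def)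
    show "slp_output p (map r [0..<m]) inp = vec m (\<lambda>i. f i inp)" if "length inp = N" for inp
      using r(2) that by (intro eq_vecI) (auto simp: slp_output_def vec_of_list_index)
  qed (use p in auto)
qed

text \<open>Two sketched factors cost \<open>2 * (3 * k + D)\<close>, their pairwise products
  \<open>D\<^sup>2\<close>, and the combination with the weights \<open>3 * D\<^sup>2 + 1\<close>.
  The scaling \<open>s\<close> is absorbed into the stored weights.\<close>

lemma applies_to_rank_one2I:
  assumes S: "S \<in> carrier_mat m (k * k)"
    and row: "\<And>i. i < m \<Longrightarrow> \<exists>T1 T2 w. sk_into k D T1 \<and> sk_into k D T2 \<and>
        (\<forall>j<k * k. S $$ (i, j) = s * sk_row (sk_kron k D T1 T2) w j)"
  shows "applies_to_rank_one2_within S k (real (m * (6 * k + 2 * D + 4 * D\<^sup>2 + 1)))"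
proof -
  obtain T1 T2 w where into: "\<And>i. i < m \<Longrightarrow> sk_into k D (T1 i)" "\<And>i. i < m \<Longrightarrow> sk_into k D (T2 i)"
    and S_eq: "\<And>i j. i < m \<Longrightarrow> j < k * k \<Longrightarrow> S $$ (i, j) = s * sk_row (sk_kron k D (T1 i) (T2 i)) (w i) j"
    using row by metis
  define A where "A i u inp = sk_apply k (T1 i) (\<lambda>j. inp ! j) u" for i u and inp :: "real list"
  define B where "B i v inp = sk_apply k (T2 i) (\<lambda>j. inp ! (k + j)) v" for i v and inp :: "real list"
  define f where "f i inp = (\<Sum>q\<in>{..<D} \<times> {..<D}. (s * w i (fst q * D + snd q)) *
      (A i (fst q) inp * B i (snd q) inp))" for i inp
  let ?F = "(\<lambda>i inp. inp ! i) ` {..<2 * k} :: (real list \<Rightarrow> real) set"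
  have ext: "slp_extends (2 * k) (6 * k + 2 * D + 4 * D\<^sup>2 + 1) ?F {f i}" if i: "i < m" for i
  proof -
    have 1: "slp_extends (2 * k) (3 * k + D) ?F (A i ` {..<D})"
      unfolding A_def[abs_def] using into(1)[OF i] by (intro slp_extends_sk_apply) auto
    have 2: "slp_extends (2 * k) (3 * k + D) (?F \<union> A i ` {..<D}) (B i ` {..<D})"
      unfolding B_def[abs_def] using into(2)[OF i] by (intro slp_extends_sk_apply) auto
    let ?G = "?F \<union> (A i ` {..<D} \<union> B i ` {..<D})"
    let ?P = "(\<lambda>q x. A i (fst q) x * B i (snd q) x) ` ({..<D} \<times> {..<D})"
    have 3: "slp_extends (2 * k) (D * D) ?G ?P"
      using slp_extends_products[of D "A i" ?G D "B i"] by (auto simp: case_prod_unfold)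
    have 4: "slp_extends (2 * k) (3 * card ({..<D} \<times> {..<D}) + 1) (?G \<union> ?P) {f i}"
      unfolding f_def[abs_def] by (intro slp_extends_lincomb) auto
    show ?thesis using slp_extends_trans[OF slp_extends_trans[OF 1 2] slp_extends_trans[OF 3 4]]
      by (rule slp_extends_mono) (auto simp: card_cartesian_product power2_eq_square)
  qed
  have "slp_extends (2 * k) (\<Sum>i<m. 6 * k + 2 * D + 4 * D\<^sup>2 + 1) ?F (\<Union>i<m. {f i})"
    by (intro slp_extends_UN ext) auto
  then have "slp_extends (2 * k) (m * (6 * k + 2 * D + 4 * D\<^sup>2 + 1)) ?F (f ` {..<m})"
    by (simp add: UNION_singleton_eq_range)
  then obtain p outs where p: "length p \<le> m * (6 * k + 2 * D + 4 * D\<^sup>2 + 1)" "slp_wf (2 * k) p outs"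
    "\<And>inp. length inp = 2 * k \<Longrightarrow> slp_output p outs inp = vec m (\<lambda>i. f i inp)"
    by (rule slp_realises) blast
  show ?thesis
    unfolding applies_to_rank_one2_within_def
  proof (intro exI[of _ p] exI[of _ outs] conjI ballI)
    show "real (length p) \<le> real (m * (6 * k + 2 * D + 4 * D\<^sup>2 + 1))" using p(1) by (rule of_nat_mono)
    fix a b :: "real vec" assume a: "a \<in> carrier_vec k" and b: "b \<in> carrier_vec k"
    let ?inp = "list_of_vec a @ list_of_vec b"
    have dims: "dim_vec a = k" "dim_vec b = k" using a b by auto
    have len: "length ?inp = 2 * k" using dims by simp
    have nth: "?inp ! j = a $ j" "?inp ! (k + j) = b $ j" if "j < k" for j
      using that dims by (auto simp: nth_append list_of_vec_index)
    have "f i ?inp = (S *\<^sub>v kron_vec a b) $ i" if i: "i < m" for i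
    proof -
      have "f i ?inp = s * (\<Sum>(u, v)\<in>{..<D} \<times> {..<D}. w i (u * D + v) *
          (sk_apply k (T1 i) (($) a) u * sk_apply k (T2 i) (($) b) v))"
        unfolding f_def A_def B_def
        by (simp add: nth sum_distrib_left case_prod_unfold mult.assoc
            cong: sk_apply_cong sum.cong)
      also have "\<dots> = (\<Sum>j<k * k. S $$ (i, j) * (a $ (j div k) * b $ (j mod k)))"
        unfolding row_kron2[OF into(1)[OF i] into(2)[OF i], symmetric]
        by (simp add: sum_distrib_left S_eq[OF i] mult.assoc)
      also have "\<dots> = (S *\<^sub>v kron_vec a b) $ i"
        using S i dims by (simp add: kron_vec_def scalar_prod_def lessThan_atLeast0)
      finally show ?thesis .
    qed
    then show "slp_output p outs ?inp = S *\<^sub>v kron_vec a b"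
      unfolding p(3)[OF len] using S by (intro eq_vecI) auto
  qed (use p in auto)
qed

text \<open>The products are formed in two stages, \<open>D\<^sup>2\<close> for the first two
  factors and \<open>D ^ 3\<close> with the third; the final combination costs
  \<open>3 * D ^ 3 + 1\<close>.\<close>

lemma applies_to_rank_one3I:
  assumes S: "S \<in> carrier_mat m (k * k * k)"
    and row: "\<And>i. i < m \<Longrightarrow> \<exists>T1 T2 T3 w. sk_into k D T1 \<and> sk_into k D T2 \<and> sk_into k D T3 \<and>
        (\<forall>j<k * k * k. S $$ (i, j) = s * sk_row (sk_kron k D (sk_kron k D T1 T2) T3) w j)"
  shows "applies_to_rank_one3_within S k (real (m * (9 * k + 3 * D + D\<^sup>2 + 4 * D ^ 3 + 1)))"
proof -
  obtain T1 T2 T3 w where into: "\<And>i. i < m \<Longrightarrow> sk_into k D (T1 i)"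
      "\<And>i. i < m \<Longrightarrow> sk_into k D (T2 i)" "\<And>i. i < m \<Longrightarrow> sk_into k D (T3 i)"
    and S_eq: "\<And>i j. i < m \<Longrightarrow> j < k * k * k \<Longrightarrow>
      S $$ (i, j) = s * sk_row (sk_kron k D (sk_kron k D (T1 i) (T2 i)) (T3 i)) (w i) j"
    using row by metis
  define A where "A i u inp = sk_apply k (T1 i) (\<lambda>j. inp ! j) u" for i u and inp :: "real list"
  define B where "B i v inp = sk_apply k (T2 i) (\<lambda>j. inp ! (k + j)) v" for i v and inp :: "real list"
  define C where "C i z inp = sk_apply k (T3 i) (\<lambda>j. inp ! (2 * k + j)) z" for i z and inp :: "real list"
  define f where "f i inp = (\<Sum>q\<in>({..<D} \<times> {..<D}) \<times> {..<D}.
      (s * w i ((fst (fst q) * D + snd (fst q)) * D + snd q)) *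
      (A i (fst (fst q)) inp * B i (snd (fst q)) inp * C i (snd q) inp))" for i inp
  let ?F = "(\<lambda>i inp. inp ! i) ` {..<3 * k} :: (real list \<Rightarrow> real) set"
  let ?t = "9 * k + 3 * D + D\<^sup>2 + 4 * D ^ 3 + 1"
  have ext: "slp_extends (3 * k) ?t ?F {f i}" if i: "i < m" for i
  proof -
    have 1: "slp_extends (3 * k) (3 * k + D) ?F (A i ` {..<D})"
      unfolding A_def[abs_def] using into(1)[OF i] by (intro slp_extends_sk_apply) auto
    have 2: "slp_extends (3 * k) (3 * k + D) (?F \<union> A i ` {..<D}) (B i ` {..<D})"
      unfolding B_def[abs_def] using into(2)[OF i] by (intro slp_extends_sk_apply) auto
    have 3: "slp_extends (3 * k) (3 * k + D) (?F \<union> (A i ` {..<D} \<union> B i ` {..<D})) (C i ` {..<D})"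
      unfolding C_def[abs_def] using into(3)[OF i] by (intro slp_extends_sk_apply) auto
    let ?G = "?F \<union> (A i ` {..<D} \<union> B i ` {..<D} \<union> C i ` {..<D})"
    let ?P = "(\<lambda>q x. A i (fst q) x * B i (snd q) x) ` ({..<D} \<times> {..<D})"
    have 4: "slp_extends (3 * k) (D * D) ?G ?P"
      using slp_extends_products[of D "A i" ?G D "B i"] by (auto simp: case_prod_unfold)
    let ?Q = "(\<lambda>q x. A i (fst (fst q)) x * B i (snd (fst q)) x * C i (snd q) x) ` (({..<D} \<times> {..<D}) \<times> {..<D})"
    have "slp_extends (3 * k) (\<Sum>q\<in>({..<D} \<times> {..<D}) \<times> {..<D}. 1) (?G \<union> ?P)
        (\<Union>q\<in>({..<D} \<times> {..<D}) \<times> {..<D}. {\<lambda>x. A i (fst (fst q)) x * B i (snd (fst q)) x * C i (snd q) x})"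
      by (intro slp_extends_UN slp_extends_mult) auto
    then have 5: "slp_extends (3 * k) (D * D * D) (?G \<union> ?P) ?Q"
      by (simp add: UNION_singleton_eq_range)
    have 6: "slp_extends (3 * k) (3 * card (({..<D} \<times> {..<D}) \<times> {..<D}) + 1) (?G \<union> ?P \<union> ?Q) {f i}"
      unfolding f_def[abs_def] by (intro slp_extends_lincomb) auto
    have 7: "slp_extends (3 * k) (3 * k + D + (3 * k + D) + (3 * k + D)) ?F
        (A i ` {..<D} \<union> B i ` {..<D} \<union> C i ` {..<D})"
      using slp_extends_trans[OF slp_extends_trans[OF 1 2] 3] .
    show ?thesis using slp_extends_trans[OF 7 slp_extends_trans[OF 4 slp_extends_trans[OF 5 6]]]
      by (rule slp_extends_mono) (auto simp: card_cartesian_product power2_eq_square power3_eq_cube)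
  qed
  have "slp_extends (3 * k) (\<Sum>i<m. ?t) ?F (\<Union>i<m. {f i})"
    by (intro slp_extends_UN ext) auto
  then have "slp_extends (3 * k) (m * ?t) ?F (f ` {..<m})"
    by (simp add: UNION_singleton_eq_range)
  then obtain p outs where p: "length p \<le> m * ?t" "slp_wf (3 * k) p outs"
    "\<And>inp. length inp = 3 * k \<Longrightarrow> slp_output p outs inp = vec m (\<lambda>i. f i inp)"
    by (rule slp_realises) blast
  show ?thesis
    unfolding applies_to_rank_one3_within_def
  proof (intro exI[of _ p] exI[of _ outs] conjI ballI)
    show "real (length p) \<le> real (m * ?t)" using p(1) by (rule of_nat_mono)
    fix a b c :: "real vec"
    assume a: "a \<in> carrier_vec k" and b: "b \<in> carrier_vec k" and c: "c \<in> carrier_vec k"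
    let ?inp = "list_of_vec a @ list_of_vec b @ list_of_vec c"
    have dims: "dim_vec a = k" "dim_vec b = k" "dim_vec c = k" using a b c by auto
    have len: "length ?inp = 3 * k" using dims by simp
    have nth: "?inp ! j = a $ j" "?inp ! (k + j) = b $ j" "?inp ! (2 * k + j) = c $ j" if "j < k" for j
      using that dims by (auto simp: nth_append list_of_vec_index)
    have "f i ?inp = (S *\<^sub>v kron_vec (kron_vec a b) c) $ i" if i: "i < m" for i
    proof -
      have "f i ?inp = s * (\<Sum>((u, v), z)\<in>({..<D} \<times> {..<D}) \<times> {..<D}. w i ((u * D + v) * D + z) *
          (sk_apply k (T1 i) (($) a) u * sk_apply k (T2 i) (($) b) v * sk_apply k (T3 i) (($) c) z))"
        unfolding f_def A_def B_def C_def
        by (simp add: nth sum_distrib_left case_prod_unfold mult.assoc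
            cong: sk_apply_cong sum.cong)
      also have "\<dots> = (\<Sum>j<k * k * k. S $$ (i, j) * (a $ (j div k div k) * b $ (j div k mod k) * c $ (j mod k)))"
        unfolding row_kron3[OF into(1)[OF i] into(2)[OF i] into(3)[OF i], symmetric]
        by (simp add: sum_distrib_left S_eq[OF i] mult.assoc)
      also have "\<dots> = (\<Sum>j<k * k * k. S $$ (i, j) * kron_vec (kron_vec a b) c $ j)"
        using dims by (intro sum.cong refl) (simp add: kron_vec_def less_mult_imp_div_less)
      also have "\<dots> = (S *\<^sub>v kron_vec (kron_vec a b) c) $ i"
        using S i dims by (simp add: kron_vec_def scalar_prod_def lessThan_atLeast0)
      finally show ?thesis .
    qed
    then show "slp_output p outs ?inp = S *\<^sub>v kron_vec (kron_vec a b) c"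
      unfolding p(3)[OF len] using S by (intro eq_vecI) auto
  qed (use p in auto)
qed

section \<open>Heavy-tailed random linear forms\<close>

text \<open>The distribution on powers of two with tail \<open>P (W \<ge> 2 ^ j) = 2 ^ -j\<close> for \<open>j \<le> J\<close>.\<close>

primrec dyadic_tail :: "nat \<Rightarrow> real pmf" where
  "dyadic_tail 0 = return_pmf 1"
| "dyadic_tail (Suc J) = bind_pmf (bernoulli_pmf (1/2))
     (\<lambda>b. if b then return_pmf 1 else map_pmf ((*) 2) (dyadic_tail J))"

lemma finite_set_dyadic_tail [simp]: "finite (set_pmf (dyadic_tail J))"
  by (induction J) (auto intro!: finite_set_bind_pmf)

lemma dyadic_tail_pos: "w \<in> set_pmf (dyadic_tail J) \<Longrightarrow> 0 < w"
  by (induction J arbitrary: w) (auto simp: set_bind_pmf split: if_splits)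

lemma expect_dyadic_tail_Suc:
  "expect (dyadic_tail (Suc J)) f = (f 1 + expect (dyadic_tail J) (\<lambda>w. f (2 * w))) / 2"
  by (simp add: expect_bind)

text \<open>Values of \<open>a * w\<close> below \<open>t\<close> contribute a geometric sum
  dominated by its last term, of order \<open>a * t\<close>; the tail has probability of order
  \<open>a / t\<close> and contributes \<open>t\<^sup>2\<close> times that. The induction runs on a
  sharper claim for \<open>a \<le> 2 * t\<close>. For \<open>t \<le> a\<close> that claim follows
  from \<open>0 \<le> (a - t) * (2 * t - a)\<close>, which is where \<open>3 / 2\<close> comes
  from.\<close>

lemma dyadic_tail_truncated_square:
  assumes "0 \<le> a" "0 < t"
  shows "expect (dyadic_tail J) (\<lambda>w. min ((a * w)\<^sup>2) (t\<^sup>2)) \<le> 3 / 2 * a * t"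
proof -
  have trunc: "expect (dyadic_tail J) (\<lambda>w. min ((a * w)\<^sup>2) (t\<^sup>2)) \<le> t\<^sup>2" for a J
  proof -
    have "expect (dyadic_tail J) (\<lambda>w. min ((a * w)\<^sup>2) (t\<^sup>2)) \<le> expect (dyadic_tail J) (\<lambda>w. t\<^sup>2)"
      by (intro expect_mono) auto
    then show ?thesis by simp
  qed
  text \<open>The correction \<open>- a\<^sup>2 / 2\<close> makes the recursion \<open>F (a) = (a\<^sup>2 + F (2 a)) / 2\<close> close.\<close>
  have "0 \<le> a \<Longrightarrow> a \<le> 2 * t \<Longrightarrow>
      expect (dyadic_tail J) (\<lambda>w. min ((a * w)\<^sup>2) (t\<^sup>2)) \<le> 3 / 2 * a * t - a\<^sup>2 / 2 " for a
  proof (induction J arbitrary: a)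
    case 0
    show ?case
    proof (cases "a \<le> t")
      case True
      then have "a * a \<le> a * t" using 0 by (intro mult_left_mono) auto
      then show ?thesis by (simp add: power2_eq_square)
    next
      case False
      have "0 \<le> (a - t) * (2 * t - a)" using 0 False by (intro mult_nonneg_nonneg) auto
      then show ?thesis by (simp add: power2_eq_square algebra_simps)
    qed
  next
    case (Suc J)
    show ?case
    proof (cases "a \<le> t")
      case True
      have "expect (dyadic_tail J) (\<lambda>w. min ((2 * a * w)\<^sup>2) (t\<^sup>2)) \<le> 3 / 2 * (2 * a) * t - (2 * a)\<^sup>2 / 2"
        using Suc True by (intro Suc.IH) auto
      then have "expect (dyadic_tail (Suc J)) (\<lambda>w. min ((a * w)\<^sup>2) (t\<^sup>2))
          \<le> (a\<^sup>2 + (3 / 2 * (2 * a) * t - (2 * a)\<^sup>2 / 2)) / 2"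
        unfolding expect_dyadic_tail_Suc by (simp add: mult_ac min.coboundedI1)
      then show ?thesis by (simp add: power2_eq_square algebra_simps)
    next
      case False
      have "0 \<le> (a - t) * (2 * t - a)" using Suc False by (intro mult_nonneg_nonneg) auto
      then have "t\<^sup>2 \<le> 3 / 2 * a * t - a\<^sup>2 / 2" by (simp add: power2_eq_square algebra_simps)
      then show ?thesis using trunc[of "Suc J" a] by linarith
    qed
  qed
  note * = this
  show ?thesis
  proof (cases "a \<le> 2 * t")
    case True
    then show ?thesis using *[OF assms(1)] zero_le_power2[of a] by linarith
  next
    case False
    have "t * t \<le> 3 / 2 * a * t" using assms False by (intro mult_right_mono) auto
    then show ?thesis using trunc[of J a] by (simp add: power2_eq_square)
  qed
qed

text \<open>Rounding \<open>t / a\<close> up to a power of two costs the factor 2. The condition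
  \<open>t \<le> a * 2 ^ J\<close> says that the largest weight still reaches the level
  \<open>t\<close>.\<close>

lemma dyadic_tail_lower:
  assumes "0 \<le> a" "0 < t" "t \<le> a * 2 ^ J"
  shows "min 1 (a / (2 * t)) \<le> expect (dyadic_tail J) (\<lambda>w. of_bool (t \<le> a * w))"
  using assms(1,3)
proof (induction J arbitrary: a)
  case 0
  then show ?case by (simp add: min.coboundedI1)
next
  case (Suc J)
  have IH: "min 1 (2 * a / (2 * t)) \<le> expect (dyadic_tail J) (\<lambda>w. of_bool (t \<le> a * (2 * w)))"
    using Suc.IH[of "2 * a"] Suc.prems by (simp add: mult_ac)
  show ?case
  proof (cases "t \<le> a")
    case True
    have "1 \<le> a / t" using True \<open>0 < t\<close> by simp
    then have "min 1 (2 * a / (2 * t)) = 1" by simp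
    then show ?thesis using IH True unfolding expect_dyadic_tail_Suc by simp
  next
    case False
    have "a / t \<le> 1" using False \<open>0 < t\<close> by simp
    then have "min 1 (2 * a / (2 * t)) = a / t" "min 1 (a / (2 * t)) \<le> a / (2 * t)" by simp_all
    then show ?thesis using IH False unfolding expect_dyadic_tail_Suc by simp
  qed
qed

text \<open>A discrete symmetric substitute for a Cauchy variable, with tail of order
  \<open>1 / t\<close> up to \<open>2 ^ J\<close>. Finite support reduces every expectation to a
  finite sum.\<close>

definition heavy_weight :: "nat \<Rightarrow> real pmf" where
  "heavy_weight J = bind_pmf (dyadic_tail J) (\<lambda>w. map_pmf (\<lambda>s. s * w) random_sign)"

lemma finite_set_heavy_weight [simp]: "finite (set_pmf (heavy_weight J))"
  unfolding heavy_weight_def by (intro finite_set_bind_pmf) auto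

lemma expect_heavy_weight:
  "expect (heavy_weight J) f = expect (dyadic_tail J) (\<lambda>w. (f w + f (- w)) / 2)"
  unfolding heavy_weight_def by (simp add: expect_bind expect_random_sign)

text \<open>Averaging over the sign of \<open>z\<close> removes the cross term, so the two squares
  have mean \<open>u\<^sup>2 + z\<^sup>2\<close>, and capping preserves subadditivity. This replaces
  additivity of variances for weights whose variance grows with \<open>J\<close>.\<close>

lemma truncated_square_step:
  fixes u z t :: real
  shows "(min ((u + z)\<^sup>2) (t\<^sup>2) + min ((u - z)\<^sup>2) (t\<^sup>2)) / 2 \<le> min (u\<^sup>2) (t\<^sup>2) + min (z\<^sup>2) (t\<^sup>2)"
proof -
  have *: "(min a T + min b T) / 2 \<le> min U T + min Z T"
    if "a + b = 2 * (U + Z)" "0 \<le> U" "0 \<le> Z" "0 \<le> T" for a b U Z T :: real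
    using that by (auto simp: min_def)
  show ?thesis by (rule *) (auto simp: power2_eq_square algebra_simps)
qed

text \<open>The shift \<open>u\<close> collects the summands already drawn. Each new one adds at
  most its own truncated second moment, so no factor depending on the number of coordinates is
  lost.\<close>

lemma heavy_form_truncated_square:
  assumes "finite A" "0 < t"
  shows "expect (Pi_pmf A 0 (\<lambda>_. heavy_weight J)) (\<lambda>w. min ((u + (\<Sum>v\<in>A. w v * y v))\<^sup>2) (t\<^sup>2))
         \<le> min (u\<^sup>2) (t\<^sup>2) + 3 / 2 * t * (\<Sum>v\<in>A. \<bar>y v\<bar>)"
  using assms(1)
proof (induction A arbitrary: u rule: finite_induct)
  case empty
  show ?case by simp
next
  case (insert a A)
  let ?P = "Pi_pmf A 0 (\<lambda>_. heavy_weight J)"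
  let ?S = "3 / 2 * t * (\<Sum>v\<in>A. \<bar>y v\<bar>)"
  have upd: "(\<Sum>v\<in>insert a A. (f(a := z)) v * y v) = z * y a + (\<Sum>v\<in>A. f v * y v)" for f z
    using insert.hyps by (auto intro!: sum.cong)
  have "expect (Pi_pmf (insert a A) 0 (\<lambda>_. heavy_weight J))
      (\<lambda>w. min ((u + (\<Sum>v\<in>insert a A. w v * y v))\<^sup>2) (t\<^sup>2))
    = expect (heavy_weight J) (\<lambda>z. expect ?P (\<lambda>w. min (((u + z * y a) + (\<Sum>v\<in>A. w v * y v))\<^sup>2) (t\<^sup>2)))"
    by (subst expect_Pi_pmf_insert) (simp_all add: insert.hyps upd add.assoc del: fun_upd_apply)
  also have "\<dots> \<le> expect (heavy_weight J) (\<lambda>z. min ((u + z * y a)\<^sup>2) (t\<^sup>2) + ?S)"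
    by (intro expect_mono insert.IH) auto
  also have "\<dots> = expect (dyadic_tail J)
      (\<lambda>z. (min ((u + z * y a)\<^sup>2) (t\<^sup>2) + min ((u - z * y a)\<^sup>2) (t\<^sup>2)) / 2 + ?S)"
    unfolding expect_heavy_weight by (intro expect_cong) (simp add: field_simps)
  also have "\<dots> \<le> expect (dyadic_tail J) (\<lambda>z. min (u\<^sup>2) (t\<^sup>2) + min ((\<bar>y a\<bar> * z)\<^sup>2) (t\<^sup>2) + ?S)"
    by (intro expect_mono add_mono order_refl order_trans[OF truncated_square_step])
       (auto simp: power_mult_distrib mult_ac)
  also have "\<dots> = min (u\<^sup>2) (t\<^sup>2) + expect (dyadic_tail J) (\<lambda>z. min ((\<bar>y a\<bar> * z)\<^sup>2) (t\<^sup>2)) + ?S"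
    by (simp add: expect_add)
  also have "\<dots> \<le> min (u\<^sup>2) (t\<^sup>2) + 3 / 2 * \<bar>y a\<bar> * t + ?S"
    using dyadic_tail_truncated_square[of "\<bar>y a\<bar>" t J] \<open>0 < t\<close> by simp
  also have "\<dots> = min (u\<^sup>2) (t\<^sup>2) + 3 / 2 * t * (\<Sum>v\<in>insert a A. \<bar>y v\<bar>)"
    using insert.hyps by (simp add: algebra_simps)
  finally show ?case .
qed

text \<open>A large summand \<open>z\<close> with a random sign makes the sum large with probability at least one
  half, whatever the other summands are. Hence the shift \<open>u\<close>.\<close>

lemma heavy_form_lower:
  assumes "finite A" "0 < t" "\<And>v. v \<in> A \<Longrightarrow> 0 \<le> q v" "\<And>v. v \<in> A \<Longrightarrow> q v \<le> 1"
    and q: "\<And>v. v \<in> A \<Longrightarrow> q v \<le> expect (dyadic_tail J) (\<lambda>w. of_bool (t \<le> \<bar>y v\<bar> * w))"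
  shows "(1 - exp (- (\<Sum>v\<in>A. q v))) / 2
         \<le> expect (Pi_pmf A 0 (\<lambda>_. heavy_weight J)) (\<lambda>w. of_bool (t \<le> \<bar>u + (\<Sum>v\<in>A. w v * y v)\<bar>))"
  using assms(1,3-)
proof (induction A arbitrary: u rule: finite_induct)
  case empty
  show ?case by simp
next
  case (insert a A)
  let ?P = "Pi_pmf A 0 (\<lambda>_. heavy_weight J)"
  define e where "e = (1 - exp (- (\<Sum>v\<in>A. q v))) / 2"
  define Q where "Q = expect (dyadic_tail J) (\<lambda>w. of_bool (t \<le> \<bar>y a\<bar> * w))"
  define G where "G u = expect ?P (\<lambda>w. of_bool (t \<le> \<bar>u + (\<Sum>v\<in>A. w v * y v)\<bar>))" for u
  have IH: "e \<le> G u" for u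
    unfolding e_def G_def using insert.prems by (intro insert.IH) auto
  have sym: "1 \<le> G (u + z) + G (u - z)" if "t \<le> \<bar>z\<bar>" for u z
  proof -
    have "1 = expect ?P (\<lambda>w. 1)" by simp
    also have "\<dots> \<le> expect ?P (\<lambda>w. of_bool (t \<le> \<bar>u + z + (\<Sum>v\<in>A. w v * y v)\<bar>)
        + of_bool (t \<le> \<bar>u - z + (\<Sum>v\<in>A. w v * y v)\<bar>))"
      using that by (intro expect_mono) (auto intro!: finite_set_Pi_pmf simp: insert.hyps)
    also have "\<dots> = G (u + z) + G (u - z)"
      unfolding G_def by (intro expect_add finite_set_Pi_pmf) (auto simp: insert.hyps)
    finally show ?thesis .
  qed
  have upd: "(\<Sum>v\<in>insert a A. (f(a := z)) v * y v) = z * y a + (\<Sum>v\<in>A. f v * y v)" for f z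
    using insert.hyps by (auto intro!: sum.cong)
  have e: "e \<le> 1 / 2" by (simp add: e_def)
  \<comment> \<open>With probability \<open>Q\<close> the new summand is large and its sign alone
    yields 1/2; otherwise the other summands yield \<open>e\<close>. The mixture is
    \<open>e + (1 / 2 - e) * Q\<close>, and as \<open>1 / 2 - e\<close> is half of an exponential,
    \<open>1 - q a \<le> exp (- q a)\<close> gives the recursion.\<close>
  have "(1 - exp (- (\<Sum>v\<in>insert a A. q v))) / 2 \<le> e + (1 / 2 - e) * q a"
  proof -
    have "(1 - q a) * exp (- (\<Sum>v\<in>A. q v)) \<le> exp (- q a) * exp (- (\<Sum>v\<in>A. q v))"
      using exp_ge_add_one_self[of "- q a"] by (intro mult_right_mono) auto
    also have "\<dots> = exp (- (\<Sum>v\<in>insert a A. q v))"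
      using insert.hyps by (simp add: exp_add[symmetric])
    finally show ?thesis by (simp add: e_def field_simps)
  qed
  also have "\<dots> \<le> e + (1 / 2 - e) * Q"
    using insert.prems(3)[of a] e by (intro add_left_mono mult_left_mono) (auto simp: Q_def)
  also have "\<dots> = expect (dyadic_tail J) (\<lambda>z. e + (1 / 2 - e) * of_bool (t \<le> \<bar>y a\<bar> * z))"
    unfolding Q_def by (simp add: expect_add)
  also have "\<dots> \<le> expect (dyadic_tail J) (\<lambda>z. (G (u + z * y a) + G (u - z * y a)) / 2)"
  proof (intro expect_mono finite_set_dyadic_tail)
    fix z assume z: "z \<in> set_pmf (dyadic_tail J)"
    show "e + (1 / 2 - e) * of_bool (t \<le> \<bar>y a\<bar> * z) \<le> (G (u + z * y a) + G (u - z * y a)) / 2"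
    proof (cases "t \<le> \<bar>y a\<bar> * z")
      case True
      then have "t \<le> \<bar>z * y a\<bar>" using dyadic_tail_pos[OF z] by (simp add: abs_mult mult.commute)
      from sym[OF this, of u] True show ?thesis by simp
    next
      case False
      then show ?thesis using IH[of "u + z * y a"] IH[of "u - z * y a"] by simp
    qed
  qed
  also have "\<dots> = expect (heavy_weight J) (\<lambda>z. G (u + z * y a))"
    by (simp add: expect_heavy_weight)
  also have "\<dots> = expect (Pi_pmf (insert a A) 0 (\<lambda>_. heavy_weight J))
      (\<lambda>w. of_bool (t \<le> \<bar>u + (\<Sum>v\<in>insert a A. w v * y v)\<bar>))"
    unfolding G_def
    by (subst expect_Pi_pmf_insert) (simp_all add: insert.hyps upd add.assoc del: fun_upd_apply)
  finally show ?case .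
qed

lemma one_minus_exp_ge:
  fixes r :: real
  assumes "0 \<le> r" "r \<le> 1"
  shows "r / 2 \<le> 1 - exp (- r)"
proof -
  have "exp (- r) \<le> 1 / (1 + r)"
    using exp_ge_add_one_self[of r] assms by (simp add: exp_minus inverse_eq_divide frac_le)
  moreover have "r / 2 \<le> r / (1 + r)" using assms by (intro divide_left_mono) auto
  moreover have "1 - 1 / (1 + r) = r / (1 + r)" using assms by (simp add: field_simps)
  ultimately show ?thesis by linarith
qed

text \<open>Coordinates below \<open>\<theta> / d\<close> are discarded: their total mass is at most
  \<open>\<theta>\<close>, and every other one reaches the level \<open>t\<close> with the largest
  weight. The denominator \<open>8 * t\<close> collects three factors 2: dyadic rounding, the
  estimate of \<open>1 - exp (- r)\<close>, and the random sign. The cap \<open>X \<le> t\<close>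
  keeps \<open>r\<close> in the range of that estimate.\<close>

lemma heavy_form_lower_l1:
  assumes "0 < X" "X \<le> t" "0 < \<theta>" "real d * t \<le> \<theta> * 2 ^ J"
  shows "(min (l1 d y) X - \<theta>) / (8 * t)
    \<le> expect (Pi_pmf {..<d} 0 (\<lambda>_. heavy_weight J)) (\<lambda>w. of_bool (t \<le> \<bar>\<Sum>v<d. w v * y v\<bar>))"
    (is "?L \<le> ?R")
proof -
  define R where "R = ?R"
  define B where "B = {v. v < d \<and> \<theta> / d \<le> \<bar>y v\<bar>}"
  define q where "q v = (if v \<in> B then min 1 (\<bar>y v\<bar> / (2 * t)) else 0)" for v
  define r where "r = (min (l1 d y) X - \<theta>) / (2 * t)"
  have t: "0 < t" using assms by linarith
  have q_nonneg: "0 \<le> q v" for v using t by (simp add: q_def)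
  have "(1 - exp (- (\<Sum>v<d. q v))) / 2 \<le> expect (Pi_pmf {..<d} 0 (\<lambda>_. heavy_weight J))
      (\<lambda>w. of_bool (t \<le> \<bar>0 + (\<Sum>v<d. w v * y v)\<bar>))"
  proof (intro heavy_form_lower)
    fix v assume v: "v \<in> {..<d}"
    show "q v \<le> expect (dyadic_tail J) (\<lambda>w. of_bool (t \<le> \<bar>y v\<bar> * w))"
    proof (cases "v \<in> B")
      case True
      have "t \<le> \<theta> / d * 2 ^ J" using assms(4) v by (simp add: field_simps)
      also have "\<dots> \<le> \<bar>y v\<bar> * 2 ^ J" using True by (intro mult_right_mono) (auto simp: B_def)
      finally show ?thesis using True t by (simp add: q_def dyadic_tail_lower)
    next
      case False
      then show ?thesis by (auto simp: q_def intro!: Bochner_Integration.integral_nonneg)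
    qed
  qed (use t q_nonneg in \<open>auto simp: q_def\<close>)
  then have 1: "(1 - exp (- (\<Sum>v<d. q v))) / 2 \<le> R" by (simp add: R_def)
  have r1: "r \<le> 1" using assms t by (simp add: r_def)
  \<comment> \<open>If some \<open>q v\<close> is capped at 1, the sum is at least 1 and hence at
    least \<open>r\<close>; otherwise no cap is active and the sum is linear in the retained
    \<open>\<bar>y v\<bar>\<close>.\<close>
  have rq: "r \<le> (\<Sum>v<d. q v)"
  proof (cases "\<exists>v<d. q v = 1")
    case True
    then obtain v where "v < d" "q v = 1" by blast
    then have "1 \<le> (\<Sum>v<d. q v)"
      using member_le_sum[of v "{..<d}" q] q_nonneg by auto
    then show ?thesis using r1 by linarith
  next
    case False
    then have q_eq: "q v = \<bar>y v\<bar> / (2 * t) * of_bool (v \<in> B)" if "v < d" for v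
      using that by (auto simp: q_def min_def)
    have "l1 d y \<le> (\<Sum>v<d. \<bar>y v\<bar> * of_bool (v \<in> B) + \<theta> / d)"
      unfolding l1_def using \<open>0 < \<theta>\<close> by (intro sum_mono) (auto simp: B_def)
    also have "\<dots> \<le> (\<Sum>v<d. \<bar>y v\<bar> * of_bool (v \<in> B)) + \<theta>"
      using \<open>0 < \<theta>\<close> by (simp add: sum.distrib)
    also have "(\<Sum>v<d. \<bar>y v\<bar> * of_bool (v \<in> B)) = 2 * t * (\<Sum>v<d. q v)"
      using t by (simp add: q_eq sum_distrib_left)
    finally have "l1 d y - \<theta> \<le> 2 * t * (\<Sum>v<d. q v)" by simp
    then show ?thesis using t by (simp add: r_def field_simps min.coboundedI1)
  qed
  show ?thesis
  proof (cases "0 \<le> r")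
    case True
    have "r / 2 \<le> 1 - exp (- r)" using one_minus_exp_ge True r1 by blast
    also have "\<dots> \<le> 1 - exp (- (\<Sum>v<d. q v))" using rq by simp
    finally have "r / 4 \<le> (1 - exp (- (\<Sum>v<d. q v))) / 2" by simp
    from order_trans[OF this 1] have "r / 4 \<le> R" .
    then show ?thesis by (simp add: r_def R_def)
  next
    case False
    then have "min (l1 d y) X - \<theta> \<le> 0" using t by (auto simp: r_def zero_le_divide_iff not_le min_def)
    then have "?L \<le> 0" using t by (intro divide_nonpos_pos) auto
    also have "0 \<le> ?R" by (intro Bochner_Integration.integral_nonneg) auto
    finally show ?thesis .
  qed
qed

section \<open>Sums of independent heavy-tailed variables\<close>

text \<open>A dyadic layer-cake bound: the levels \<open>2 ^ j * X\<close> up to the largest one not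
  above \<open>u\<close>, each halved, sum to at most that level.\<close>

lemma truncation_ge_dyadic:
  fixes u X :: real
  assumes "0 \<le> X" "0 \<le> u"
  shows "(\<Sum>j\<le>g. 2 ^ j * X / 2 * of_bool (2 ^ j * X \<le> u)) \<le> min u (2 ^ g * X)"
proof -
  have le: "(\<Sum>j\<le>g. 2 ^ j * X / 2 * of_bool (2 ^ j * X \<le> u)) \<le> 2 ^ g * X" for g
  proof (induction g)
    case (Suc g)
    have "2 ^ Suc g * X / 2 * of_bool (2 ^ Suc g * X \<le> u) \<le> 2 ^ g * X" using assms by simp
    moreover have "2 ^ Suc g * X = 2 ^ g * X + 2 ^ g * X" by simp
    ultimately show ?case using Suc unfolding sum.atMost_Suc by linarith
  qed (use assms in auto)
  have "(\<Sum>j\<le>g. 2 ^ j * X / 2 * of_bool (2 ^ j * X \<le> u)) \<le> u" for g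
  proof (induction g)
    case (Suc g)
    show ?case
    proof (cases "2 ^ Suc g * X \<le> u")
      case True
      then show ?thesis using le[of g] by simp
    qed (use Suc in simp)
  qed (use assms in auto)
  with le show ?thesis by simp
qed

text \<open>Doubling the cap from \<open>t\<close> to \<open>2 * t\<close> gains nothing if
  \<open>u \<le> t\<close> and at most \<open>t\<close> otherwise, which
  \<open>min (u\<^sup>2) (t\<^sup>2) / t\<close> dominates. With a truncated second moment of order
  \<open>t * X\<close>, each doubling adds a constant multiple of \<open>X\<close> to the truncated
  mean.\<close>

lemma truncation_le_dyadic:
  fixes u X :: real
  assumes "0 < X" "0 \<le> u"
  shows "min u (2 ^ g * X) \<le> X + (\<Sum>j<g. min (u\<^sup>2) ((2 ^ j * X)\<^sup>2) / (2 ^ j * X))"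
proof (induction g)
  case (Suc g)
  define t where "t = 2 ^ g * X"
  have t: "0 < t" using assms by (simp add: t_def)
  have "min u (2 * t) \<le> min u t + min (u\<^sup>2) (t\<^sup>2) / t"
  proof (cases "u \<le> t")
    case True
    have "0 \<le> min (u\<^sup>2) (t\<^sup>2) / t" using t by simp
    then show ?thesis using True by simp
  next
    case False
    then have "t\<^sup>2 \<le> u\<^sup>2" using t by (intro power_mono) auto
    then have "min (u\<^sup>2) (t\<^sup>2) / t = t" using t by (simp add: power2_eq_square)
    then show ?thesis using False by simp
  qed
  then show ?case using Suc by (simp add: t_def mult.assoc)
qed (use assms in auto)

text \<open>Tails of order \<open>X / t\<close>, in the form in which heavy-tailed linear forms
  deliver them. The upper condition implies that \<open>t \<le> \<bar>\<phi> r\<bar>\<close> has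
  probability at most \<open>3 / 2 * X / t\<close>. The lower one covers only a window, as the
  weights are bounded; the window suffices because the lower tail of the average is estimated with
  truncation at \<open>2 ^ g * X\<close>.\<close>

locale cauchy_like =
  fixes p :: "'a pmf" and \<phi> :: "'a \<Rightarrow> real" and X c :: real and g :: nat
  assumes fin: "finite (set_pmf p)" and X: "0 < X" and c: "0 \<le> c" and g: "0 < g"
    and upper: "\<And>t. 0 < t \<Longrightarrow> expect p (\<lambda>r. min ((\<phi> r)\<^sup>2) (t\<^sup>2)) \<le> 3 / 2 * t * X"
    and lower: "\<And>t. X \<le> t \<Longrightarrow> t \<le> 2 ^ g * X \<Longrightarrow>
          c * X / t \<le> expect p (\<lambda>r. of_bool (t \<le> \<bar>\<phi> r\<bar>))"
begin

lemma truncated_mean_le: "expect p (\<lambda>r. min \<bar>\<phi> r\<bar> (2 ^ G * X)) \<le> X * (1 + 3 / 2 * G)"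
proof -
  have "expect p (\<lambda>r. min \<bar>\<phi> r\<bar> (2 ^ G * X))
      \<le> expect p (\<lambda>r. X + (\<Sum>j<G. min (\<bar>\<phi> r\<bar>\<^sup>2) ((2 ^ j * X)\<^sup>2) / (2 ^ j * X)))"
    using X by (intro expect_mono fin truncation_le_dyadic) auto
  also have "\<dots> = X + (\<Sum>j<G. expect p (\<lambda>r. min ((\<phi> r)\<^sup>2) ((2 ^ j * X)\<^sup>2)) / (2 ^ j * X))"
    using fin by (simp add: expect_add expect_sum)
  also have "\<dots> \<le> X + (\<Sum>j<G. 3 / 2 * (2 ^ j * X) * X / (2 ^ j * X))"
    using X by (intro add_left_mono sum_mono divide_right_mono upper) auto
  also have "\<dots> = X * (1 + 3 / 2 * G)" using X by (simp add: algebra_simps)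
  finally show ?thesis .
qed

lemma truncated_mean_ge: "c / 2 * g * X \<le> expect p (\<lambda>r. min \<bar>\<phi> r\<bar> (2 ^ g * X))"
proof -
  have "c / 2 * g * X \<le> c / 2 * (g + 1) * X" using c X by (intro mult_right_mono mult_left_mono) auto
  also have "\<dots> = (\<Sum>j\<le>g. 2 ^ j * X / 2 * (c * X / (2 ^ j * X)))" using X by simp
  also have "\<dots> \<le> (\<Sum>j\<le>g. 2 ^ j * X / 2 * expect p (\<lambda>r. of_bool (2 ^ j * X \<le> \<bar>\<phi> r\<bar>)))"
    using X by (intro sum_mono mult_left_mono lower) (auto intro!: power_increasing)
  also have "\<dots> = expect p (\<lambda>r. \<Sum>j\<le>g. 2 ^ j * X / 2 * of_bool (2 ^ j * X \<le> \<bar>\<phi> r\<bar>))"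
    using fin by (simp add: expect_sum)
  also have "\<dots> \<le> expect p (\<lambda>r. min \<bar>\<phi> r\<bar> (2 ^ g * X))"
    using X by (intro expect_mono fin truncation_ge_dyadic) auto
  finally show ?thesis .
qed

abbreviation "m \<equiv> (4 :: nat) ^ g"
abbreviation "sample d \<equiv> Pi_pmf {..<m} d (\<lambda>_. p)"

lemma finite_set_sample: "finite (set_pmf (sample d))"
  using fin by (intro finite_set_Pi_pmf) auto

text \<open>The average is at most \<open>20 g X\<close> unless a summand exceeds \<open>R = 16 m X\<close> or the sum of the summands
  truncated at \<open>R\<close> is large; Markov's inequality is applied to both events at once.\<close>

lemma average_upper:
  "2 / 5 \<le> measure_pmf.prob (sample d) {f. (\<Sum>i<m. \<bar>\<phi> (f i)\<bar>) / (real m * g) \<le> 20 * X}"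
proof -
  \<comment> \<open>Chosen so that some summand reaches \<open>R\<close> with probability at most
    \<open>m * (3 / 2) * X / R = 3 / 32\<close>, and as a power of two times \<open>X\<close> so
    that \<open>truncated_mean_le\<close> applies. With the \<open>1 / 2\<close> from the truncated
    sum the total stays below \<open>3 / 5\<close>.\<close>
  define R where "R = 2 ^ (2 * g + 4) * X"
  have R: "R = 16 * m * X" by (simp add: R_def power_add power_mult)
  have R0: "0 < R" using X by (simp add: R_def)
  define b where "b r = min \<bar>\<phi> r\<bar> R / (20 * m * g * X) + min ((\<phi> r)\<^sup>2) (R\<^sup>2) / R\<^sup>2" for r
  have b0: "0 \<le> b r" for r using X R0 by (simp add: b_def)
  have bad: "of_bool (\<not> (\<Sum>i<m. \<bar>\<phi> (f i)\<bar>) / (real m * g) \<le> 20 * X) \<le> (\<Sum>i<m. b (f i))" for f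
  proof (cases "\<exists>i<m. R \<le> \<bar>\<phi> (f i)\<bar>")
    case True
    then obtain i where i: "i < m" "R \<le> \<bar>\<phi> (f i)\<bar>" by blast
    then have "R\<^sup>2 \<le> (\<phi> (f i))\<^sup>2" using R0 by (metis abs_of_pos power2_le_iff_abs_le power2_abs abs_le_square_iff)
    then have "1 \<le> b (f i)" using R0 X by (simp add: b_def min_absorb2)
    also have "\<dots> \<le> (\<Sum>i<m. b (f i))" using i b0 by (intro member_le_sum) auto
    finally show ?thesis by simp
  next
    case False
    then have "(\<Sum>i<m. \<bar>\<phi> (f i)\<bar>) / (20 * m * g * X) = (\<Sum>i<m. min \<bar>\<phi> (f i)\<bar> R / (20 * m * g * X))"
      unfolding sum_divide_distrib by (intro sum.cong) auto
    also have "\<dots> \<le> (\<Sum>i<m. b (f i))" using R0 by (intro sum_mono) (simp add: b_def)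
    finally have "(\<Sum>i<m. \<bar>\<phi> (f i)\<bar>) / (20 * m * g * X) \<le> (\<Sum>i<m. b (f i))" .
    moreover have "0 \<le> (\<Sum>i<m. b (f i))" using b0 by (intro sum_nonneg) auto
    moreover have "1 \<le> (\<Sum>i<m. \<bar>\<phi> (f i)\<bar>) / (20 * m * g * X)"
      if "\<not> (\<Sum>i<m. \<bar>\<phi> (f i)\<bar>) / (real m * g) \<le> 20 * X"
      using that g X by (simp add: field_simps)
    ultimately show ?thesis by fastforce
  qed
  have "expect p b = expect p (\<lambda>r. min \<bar>\<phi> r\<bar> R) / (20 * m * g * X) + expect p (\<lambda>r. min ((\<phi> r)\<^sup>2) (R\<^sup>2)) / R\<^sup>2"
    unfolding b_def using fin by (simp add: expect_add)
  also have "\<dots> \<le> X * (1 + 3 / 2 * (2 * g + 4)) / (20 * m * g * X) + 3 / 2 * R * X / R\<^sup>2"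
    using truncated_mean_le[of "2 * g + 4"] upper[OF R0] X
    by (intro add_mono divide_right_mono) (auto simp: R_def)
  also have "\<dots> \<le> (1 / 2) / m + (3 / 32) / m"
  proof (intro add_mono)
    have "1 \<le> real g" using g by simp
    then have "1 + 3 / 2 * (2 * real g + 4) \<le> 10 * real g" by (simp add: field_simps)
    then have "X * (1 + 3 / 2 * (2 * g + 4)) \<le> X * (10 * g)" using X by (intro mult_left_mono) auto
    then show "X * (1 + 3 / 2 * (2 * g + 4)) / (20 * m * g * X) \<le> (1 / 2) / m"
      using X g by (simp add: field_simps)
    show "3 / 2 * R * X / R\<^sup>2 \<le> (3 / 32) / m" using X by (simp add: R power2_eq_square)
  qed
  finally have Eb: "m * expect p b \<le> 3 / 5" by (simp add: field_simps)
  have "expect (sample d) (\<lambda>f. of_bool (\<not> (\<Sum>i<m. \<bar>\<phi> (f i)\<bar>) / (real m * g) \<le> 20 * X))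
      \<le> expect (sample d) (\<lambda>f. \<Sum>i<m. b (f i))"
    by (intro expect_mono finite_set_sample bad)
  also have "\<dots> = (\<Sum>i<m. expect (sample d) (\<lambda>f. b (f i)))" by (simp add: expect_sum finite_set_sample)
  also have "\<dots> = m * expect p b" by (simp add: expect_Pi_pmf_component)
  finally have "expect (sample d) (\<lambda>f. of_bool (\<not> (\<Sum>i<m. \<bar>\<phi> (f i)\<bar>) / (real m * g) \<le> 20 * X)) \<le> 3 / 5"
    using Eb by linarith
  moreover have "1 = expect (sample d) (\<lambda>f. of_bool ((\<Sum>i<m. \<bar>\<phi> (f i)\<bar>) / (real m * g) \<le> 20 * X)
      + of_bool (\<not> (\<Sum>i<m. \<bar>\<phi> (f i)\<bar>) / (real m * g) \<le> 20 * X))"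
    by (subst expect_cong[where g = "\<lambda>_. 1"]) auto
  ultimately show ?thesis
    unfolding prob_eq_expect by (simp add: expect_add[OF finite_set_sample])
qed

text \<open>For nonnegative summands the lower tail needs no upper moments: one Laplace factor has
  mean at most \<open>exp (- (c / 4 * g / 2 ^ g))\<close>, so \<open>4 ^ g\<close> of them give
  \<open>exp (- (c / 4 * g * 2 ^ g))\<close>. The threshold costs
  \<open>exp (c / 8 * g * 2 ^ g)\<close>, which leaves half of the exponent.\<close>

lemma average_lower:
  assumes "exp (- (c / 8 * g * 2 ^ g)) \<le> \<delta>"
  shows "1 - \<delta> \<le> measure_pmf.prob (sample d) {f. (\<Sum>i<m. \<bar>\<phi> (f i)\<bar>) / (real m * g) \<ge> c / 8 * X}"
proof -
  \<comment> \<open>The largest exponent with \<open>lam * u \<le> 1\<close> for all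
    \<open>u\<close> up to the cap \<open>2 ^ g * X\<close>, so that
    \<open>exp (- z) \<le> 1 - z / 2\<close> applies to the capped value.\<close>
  define lam where "lam = 1 / (2 ^ g * X)"
  have lam_pos: "0 < lam" using X by (simp add: lam_def)
  have m: "real m = 2 ^ g * 2 ^ g" by (simp add: power_mult_distrib[symmetric])
  have one: "expect p (\<lambda>r. exp (- (lam * \<bar>\<phi> r\<bar>))) \<le> exp (- (c / 4 * g / 2 ^ g))"
  proof -
    have "exp (- (lam * u)) \<le> 1 - lam / 2 * min u (2 ^ g * X)" if "0 \<le> u" for u
    proof -
      have "min u (2 ^ g * X) * lam \<le> 2 ^ g * X * lam" using lam_pos by (intro mult_right_mono) auto
      also have "\<dots> = 1" using X by (simp add: lam_def)
      finally have "lam * min u (2 ^ g * X) / 2 \<le> 1 - exp (- (lam * min u (2 ^ g * X)))"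
        using that lam_pos X by (intro one_minus_exp_ge) (auto simp: mult.commute)
      moreover have "exp (- (lam * u)) \<le> exp (- (lam * min u (2 ^ g * X)))"
        using lam_pos by simp
      ultimately show ?thesis unfolding times_divide_eq_left by linarith
    qed
    then have "expect p (\<lambda>r. exp (- (lam * \<bar>\<phi> r\<bar>))) \<le> expect p (\<lambda>r. 1 + (- lam / 2) * min \<bar>\<phi> r\<bar> (2 ^ g * X))"
      by (intro expect_mono fin) simp
    also have "\<dots> = 1 - lam / 2 * expect p (\<lambda>r. min \<bar>\<phi> r\<bar> (2 ^ g * X))"
      using fin by (subst expect_add) simp_all
    also have "\<dots> \<le> 1 - lam / 2 * (c / 2 * g * X)"
      using truncated_mean_ge lam_pos by (intro diff_left_mono mult_left_mono) auto
    also have "\<dots> = 1 + - (c / 4 * g / 2 ^ g)" using X by (simp add: lam_def field_simps)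
    also have "\<dots> \<le> exp (- (c / 4 * g / 2 ^ g))" by (rule exp_ge_add_one_self)
    finally show ?thesis .
  qed
  have "expect (sample d) (\<lambda>f. of_bool (\<not> (\<Sum>i<m. \<bar>\<phi> (f i)\<bar>) / (real m * g) \<ge> c / 8 * X))
     \<le> expect (sample d) (\<lambda>f. exp (c / 8 * g * 2 ^ g) * (\<Prod>i<m. exp (- (lam * \<bar>\<phi> (f i)\<bar>))))"
  proof (intro expect_mono finite_set_sample)
    fix f
    have "0 \<le> c / 8 * g * 2 ^ g - lam * (\<Sum>i<m. \<bar>\<phi> (f i)\<bar>)"
      if "\<not> (\<Sum>i<m. \<bar>\<phi> (f i)\<bar>) / (real m * g) \<ge> c / 8 * X"
    proof -
      have "(\<Sum>i<m. \<bar>\<phi> (f i)\<bar>) \<le> c / 8 * X * (real m * g)" using that g by (simp add: field_simps)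
      then have "lam * (\<Sum>i<m. \<bar>\<phi> (f i)\<bar>) \<le> lam * (c / 8 * X * (real m * g))"
        using lam_pos by (intro mult_left_mono) auto
      also have "\<dots> = c / 8 * g * 2 ^ g" using X unfolding m by (simp add: lam_def field_simps)
      finally show ?thesis by simp
    qed
    then show "of_bool (\<not> (\<Sum>i<m. \<bar>\<phi> (f i)\<bar>) / (real m * g) \<ge> c / 8 * X)
        \<le> exp (c / 8 * g * 2 ^ g) * (\<Prod>i<m. exp (- (lam * \<bar>\<phi> (f i)\<bar>)))"
      by (auto simp: exp_sum[symmetric] exp_add[symmetric] sum_negf sum_distrib_left[symmetric]
          simp del: not_le)
  qed
  also have "\<dots> = exp (c / 8 * g * 2 ^ g) * (\<Prod>i<m. expect p (\<lambda>r. exp (- (lam * \<bar>\<phi> r\<bar>))))"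
    using fin by (simp only: integral_mult_right_zero)
      (subst expectation_prod_Pi_pmf, auto intro!: integrable_measure_pmf_finite)
  also have "\<dots> \<le> exp (c / 8 * g * 2 ^ g) * (\<Prod>i<m. exp (- (c / 4 * g / 2 ^ g)))"
    by (intro mult_left_mono prod_mono conjI one Bochner_Integration.integral_nonneg) auto
  also have "\<dots> = exp (c / 8 * g * 2 ^ g + real m * (- (c / 4 * g / 2 ^ g)))"
    by (simp only: prod_constant card_lessThan exp_of_nat_mult exp_add)
  also have "c / 8 * g * 2 ^ g + real m * (- (c / 4 * g / 2 ^ g)) = - (c / 8 * g * 2 ^ g)"
    unfolding m by (simp add: field_simps)
  also have "exp \<dots> \<le> \<delta>" by (rule assms)
  finally have "expect (sample d) (\<lambda>f. of_bool (\<not> (\<Sum>i<m. \<bar>\<phi> (f i)\<bar>) / (real m * g) \<ge> c / 8 * X)) \<le> \<delta>" .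
  moreover have "1 = expect (sample d) (\<lambda>f. of_bool ((\<Sum>i<m. \<bar>\<phi> (f i)\<bar>) / (real m * g) \<ge> c / 8 * X)
      + of_bool (\<not> (\<Sum>i<m. \<bar>\<phi> (f i)\<bar>) / (real m * g) \<ge> c / 8 * X))"
    by (subst expect_cong[where g = "\<lambda>_. 1"]) auto
  ultimately show ?thesis
    unfolding prob_eq_expect by (simp add: expect_add[OF finite_set_sample])
qed

end

section \<open>Reducing the dimension to its square root\<close>

text \<open>This is Count-Sketch; the signs protect a coordinate from cancellation by whatever
  shares its bucket.\<close>

definition hash_sketch :: "nat \<Rightarrow> nat \<Rightarrow> sketch pmf" where
  "hash_sketch n d = pair_pmf (Pi_pmf {..<n} 0 (\<lambda>_. pmf_of_set {..<d})) (Pi_pmf {..<n} 0 (\<lambda>_. random_sign))"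

text \<open>Stratified sampling with one survivor per block of \<open>s\<close> consecutive indices,
  scaled by \<open>s\<close> so that every coordinate keeps its mean. For
  \<open>n \<le> s * s\<close> there are at most \<open>s\<close> blocks.\<close>

definition sample_sketch :: "nat \<Rightarrow> sketch pmf" where
  "sample_sketch s = map_pmf (\<lambda>r. (\<lambda>i. i div s, \<lambda>i. if i mod s = r (i div s) then real s else 0))
     (Pi_pmf {..<s} 0 (\<lambda>_. pmf_of_set {..<s}))"

lemma set_uniform [simp]: "0 < s \<Longrightarrow> set_pmf (pmf_of_set {..<s::nat}) = {..<s}"
  by (rule set_pmf_of_set) auto

lemma expect_uniform: "0 < s \<Longrightarrow> expect (pmf_of_set {..<s::nat}) f = (\<Sum>i<s. f i) / s"
  by (subst integral_pmf_of_set) auto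

lemma expect_pair_pmf:
  assumes "finite (set_pmf p)" "finite (set_pmf q)"
  shows "expect (pair_pmf p q) f = expect p (\<lambda>x. expect q (\<lambda>y. f (x, y)))"
  unfolding pair_pmf_def using assms
  by (simp add: expect_bind finite_set_bind_pmf)

section \<open>Hashing and the large coordinates\<close>

lemma hash_sign_cancellation:
  assumes "i < n" "h i = v"
  shows "\<bar>x i\<bar> / 2 \<le> expect (Pi_pmf {..<n} 0 (\<lambda>_. random_sign))
           (\<lambda>\<sigma>. min \<bar>sk_apply n (h, \<sigma>) x v\<bar> \<bar>x i\<bar>)"
proof -
  let ?P = "Pi_pmf {..<n} 0 (\<lambda>_. random_sign)"
  have fin: "finite (set_pmf ?P)" by (intro finite_set_Pi_pmf) auto
  define R where "R \<sigma> = (\<Sum>j\<in>{j. j < n \<and> h j = v} - {i}. \<sigma> j * x j)" for \<sigma> :: "nat \<Rightarrow> real"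
  have sk: "sk_apply n (h, \<sigma>(i := y)) x v = y * x i + R \<sigma>" for \<sigma> y
    unfolding sk_apply_def R_def using assms
    by (subst sum.remove[of _ i]) (auto intro!: sum.cong)
  have "\<bar>x i\<bar> / 2 = expect ?P (\<lambda>\<sigma>. \<bar>x i\<bar> / 2)" by simp
  \<comment> \<open>Whatever \<open>R \<sigma>\<close> is, one of \<open>x i\<close> and
    \<open>- x i\<close> does not have the opposite sign, and for that choice the sum has absolute
    value at least \<open>\<bar>x i\<bar>\<close>.\<close>
  also have "\<dots> \<le> expect ?P (\<lambda>\<sigma>. (min \<bar>x i + R \<sigma>\<bar> \<bar>x i\<bar> + min \<bar>- x i + R \<sigma>\<bar> \<bar>x i\<bar>) / 2)"
    by (intro expect_mono fin) (auto simp: min_def)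
  also have "\<dots> = expect ?P (\<lambda>\<sigma>. expect random_sign (\<lambda>y. min \<bar>sk_apply n (h, \<sigma>(i := y)) x v\<bar> \<bar>x i\<bar>))"
    by (simp add: sk expect_random_sign del: fun_upd_apply)
  also have "\<dots> = expect ?P (\<lambda>\<sigma>. min \<bar>sk_apply n (h, \<sigma>) x v\<bar> \<bar>x i\<bar>)"
    using assms by (subst expect_Pi_pmf_resample[of _ i]) auto
  finally show ?thesis .
qed

text \<open>With all other hash values frozen, \<open>L - {i}\<close> occupies at most
  \<open>s\<close> of the \<open>2 * s\<close> buckets, so at least half of the buckets are free for
  \<open>i\<close>.\<close>

lemma hash_isolation:
  fixes L :: "nat set"
  assumes "i \<in> L" "L \<subseteq> {..<n}" "card L \<le> s" "0 < s"
  shows "1 / 2 \<le> expect (Pi_pmf {..<n} 0 (\<lambda>_. pmf_of_set {..<2 * s}))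
           (\<lambda>h. of_bool (\<forall>j\<in>L. j \<noteq> i \<longrightarrow> h j \<noteq> h i))"
proof -
  let ?P = "Pi_pmf {..<n} 0 (\<lambda>_. pmf_of_set {..<2 * s})"
  have fin: "finite (set_pmf ?P)" using assms by (intro finite_set_Pi_pmf) auto
  have L: "finite L" using assms(2) finite_subset by blast
  have "1 / 2 = expect ?P (\<lambda>h. 1 / 2)" by simp
  also have "\<dots> \<le> expect ?P (\<lambda>h. expect (pmf_of_set {..<2 * s})
      (\<lambda>y. of_bool (\<forall>j\<in>L. j \<noteq> i \<longrightarrow> (h(i := y)) j \<noteq> (h(i := y)) i)))"
  proof (intro expect_mono fin)
    fix h :: "nat \<Rightarrow> nat"
    have "2 * s - s \<le> card {..<2 * s} - card (h ` (L - {i}))"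
      using card_image_le[of "L - {i}" h] card_mono[of L "L - {i}"] L assms(3) by auto
    also have "\<dots> \<le> card ({..<2 * s} - h ` (L - {i}))"
      using L by (intro diff_card_le_card_Diff) auto
    finally have "real s \<le> card ({..<2 * s} - h ` (L - {i}))" by simp
    also have "\<dots> = (\<Sum>y<2 * s. of_bool (y \<notin> h ` (L - {i})))"
      by (simp add: Collect_conj_eq set_diff_eq lessThan_def)
    also have "\<dots> = (\<Sum>y<2 * s. of_bool (\<forall>j\<in>L. j \<noteq> i \<longrightarrow> (h(i := y)) j \<noteq> (h(i := y)) i))"
      by (intro sum.cong refl arg_cong[where f = of_bool]) auto
    finally show "1 / 2 \<le> expect (pmf_of_set {..<2 * s})
        (\<lambda>y. of_bool (\<forall>j\<in>L. j \<noteq> i \<longrightarrow> (h(i := y)) j \<noteq> (h(i := y)) i))"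
      using assms(4) by (simp add: expect_uniform field_simps del: fun_upd_apply)
  qed
  also have "\<dots> = expect ?P (\<lambda>h. of_bool (\<forall>j\<in>L. j \<noteq> i \<longrightarrow> h j \<noteq> h i))"
    using assms by (subst expect_Pi_pmf_resample[of _ i]) auto
  finally show ?thesis .
qed

text \<open>The quarter is one half for isolation within \<open>L\<close> times one half for the
  random sign. Isolated elements of \<open>L\<close> sit in distinct buckets, so their contributions
  add up; coordinates outside \<open>L\<close> may share a bucket with them, which the sign takes
  care of.\<close>

lemma hash_sketch_lower:
  assumes L: "L \<subseteq> {..<n}" "card L \<le> s" and s: "0 < s"
  shows "(\<Sum>i\<in>L. \<bar>x i\<bar>) / 4
    \<le> expect (hash_sketch n (2 * s)) (\<lambda>T. min (l1 (2 * s) (sk_apply n T x)) (l1 n x))"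
proof -
  let ?H = "Pi_pmf {..<n} 0 (\<lambda>_. pmf_of_set {..<2 * s})"
  let ?S = "Pi_pmf {..<n} 0 (\<lambda>_. random_sign)"
  have finH: "finite (set_pmf ?H)" using s by (intro finite_set_Pi_pmf) auto
  have finS: "finite (set_pmf ?S)" by (intro finite_set_Pi_pmf) auto
  have finL: "finite L" using L(1) finite_subset by blast
  define iso where "iso h i \<longleftrightarrow> (\<forall>j\<in>L. j \<noteq> i \<longrightarrow> h j \<noteq> h i)" for h :: "nat \<Rightarrow> nat" and i
  have "(\<Sum>i\<in>L. \<bar>x i\<bar>) / 4 = (\<Sum>i\<in>L. 1 / 2 * (\<bar>x i\<bar> / 2))" by (simp add: sum_divide_distrib)
  also have "\<dots> \<le> (\<Sum>i\<in>L. expect ?H (\<lambda>h. of_bool (iso h i)) * (\<bar>x i\<bar> / 2))"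
    unfolding iso_def using assms by (intro sum_mono mult_right_mono hash_isolation) auto
  also have "\<dots> = expect ?H (\<lambda>h. \<Sum>i\<in>L. of_bool (iso h i) * (\<bar>x i\<bar> / 2))"
    by (subst expect_sum[OF finH]) simp
  also have "\<dots> \<le> expect ?H (\<lambda>h. expect ?S (\<lambda>\<sigma>. min (l1 (2 * s) (sk_apply n (h, \<sigma>) x)) (l1 n x)))"
  proof (intro expect_mono finH)
    fix h assume h: "h \<in> set_pmf ?H"
    have h_lt: "h i < 2 * s" if "i < n" for i
      using h that s by (auto simp: set_Pi_pmf PiE_dflt_def)
    have "(\<Sum>i\<in>L. of_bool (iso h i) * (\<bar>x i\<bar> / 2))
        \<le> (\<Sum>i\<in>L. of_bool (iso h i) * expect ?S (\<lambda>\<sigma>. min \<bar>sk_apply n (h, \<sigma>) x (h i)\<bar> \<bar>x i\<bar>))"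
      using L by (intro sum_mono mult_left_mono hash_sign_cancellation) auto
    also have "\<dots> = expect ?S (\<lambda>\<sigma>. \<Sum>i\<in>L. of_bool (iso h i) * min \<bar>sk_apply n (h, \<sigma>) x (h i)\<bar> \<bar>x i\<bar>)"
      by (subst expect_sum[OF finS]) simp
    also have "\<dots> \<le> expect ?S (\<lambda>\<sigma>. min (l1 (2 * s) (sk_apply n (h, \<sigma>) x)) (l1 n x))"
    proof (intro expect_mono finS min.boundedI)
      fix \<sigma>
      have eq: "(\<Sum>i\<in>L. of_bool (iso h i) * min \<bar>sk_apply n (h, \<sigma>) x (h i)\<bar> \<bar>x i\<bar>)
          = (\<Sum>i\<in>{i \<in> L. iso h i}. min \<bar>sk_apply n (h, \<sigma>) x (h i)\<bar> \<bar>x i\<bar>)"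
        using finL by (intro sum.mono_neutral_cong_right) auto
      also have "\<dots> \<le> (\<Sum>i\<in>{i \<in> L. iso h i}. \<bar>sk_apply n (h, \<sigma>) x (h i)\<bar>)"
        by (intro sum_mono) auto
      also have "\<dots> = (\<Sum>v\<in>h ` {i \<in> L. iso h i}. \<bar>sk_apply n (h, \<sigma>) x v\<bar>)"
        by (subst sum.reindex) (auto simp: inj_on_def iso_def)
      also have "\<dots> \<le> l1 (2 * s) (sk_apply n (h, \<sigma>) x)"
        unfolding l1_def using h_lt L by (intro sum_mono2) auto
      finally show "(\<Sum>i\<in>L. of_bool (iso h i) * min \<bar>sk_apply n (h, \<sigma>) x (h i)\<bar> \<bar>x i\<bar>) \<le> \<dots>" .
      have "(\<Sum>i\<in>L. of_bool (iso h i) * min \<bar>sk_apply n (h, \<sigma>) x (h i)\<bar> \<bar>x i\<bar>) \<le> (\<Sum>i\<in>L. \<bar>x i\<bar>)"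
        by (intro sum_mono) auto
      also have "\<dots> \<le> l1 n x" unfolding l1_def using L by (intro sum_mono2) auto
      finally show "(\<Sum>i\<in>L. of_bool (iso h i) * min \<bar>sk_apply n (h, \<sigma>) x (h i)\<bar> \<bar>x i\<bar>) \<le> l1 n x" .
    qed
    finally show "(\<Sum>i\<in>L. of_bool (iso h i) * (\<bar>x i\<bar> / 2))
      \<le> expect ?S (\<lambda>\<sigma>. min (l1 (2 * s) (sk_apply n (h, \<sigma>) x)) (l1 n x))" .
  qed
  also have "\<dots> = expect (hash_sketch n (2 * s)) (\<lambda>T. min (l1 (2 * s) (sk_apply n T x)) (l1 n x))"
    unfolding hash_sketch_def by (simp add: expect_pair_pmf finH finS)
  finally show ?thesis .
qed

section \<open>Sampling and the small coordinates\<close>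

lemma sample_sketch_apply:
  assumes "r v < s"
  shows "sk_apply n (\<lambda>i. i div s, \<lambda>i. if i mod s = r (i div s) then real s else 0) x v
         = (if v * s + r v < n then s * x (v * s + r v) else 0)"
proof -
  have eq: "i div s = v \<and> i mod s = r (i div s) \<longleftrightarrow> i = v * s + r v" for i
  proof
    assume "i div s = v \<and> i mod s = r (i div s)"
    then show "i = v * s + r v" using div_mult_mod_eq[of i s] by simp
  qed (use assms in auto)
  have "sk_apply n (\<lambda>i. i div s, \<lambda>i. if i mod s = r (i div s) then real s else 0) x v
      = (\<Sum>i<n. of_bool (i div s = v \<and> i mod s = r (i div s)) * (s * x i))"
    unfolding sk_apply_def sum_eq_of_bool by (intro sum.cong) auto
  also have "\<dots> = (\<Sum>i<n. if i = v * s + r v then s * x i else 0)"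
    unfolding eq by (intro sum.cong) auto
  finally show ?thesis by simp
qed

text \<open>The truncation is handled through
  \<open>X * (1 - exp (- (u / X))) \<le> min u X\<close>, where \<open>u\<close> is the sampled
  norm: the exponential of a sum factorises over the independent blocks. For
  \<open>s * \<bar>x i\<bar> \<le> X\<close> the exponent is at most 1, where linearising loses a
  factor 2; the other factor 2 comes from the same estimate for the total mass.\<close>

lemma sample_sketch_lower:
  assumes s: "0 < s" "n \<le> s * s" and X: "0 < l1 n x"
  shows "(\<Sum>i | i < n \<and> s * \<bar>x i\<bar> \<le> l1 n x. \<bar>x i\<bar>) / 4
    \<le> expect (sample_sketch s) (\<lambda>T. min (l1 (2 * s) (sk_apply n T x)) (l1 n x))"
proof -
  let ?R = "Pi_pmf {..<s} 0 (\<lambda>_. pmf_of_set {..<s})"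
  define X where "X = l1 n x"
  have X0: "0 < X" using X by (simp add: X_def)
  have finR: "finite (set_pmf ?R)" using s by (intro finite_set_Pi_pmf) auto
  \<comment> \<open>Padding by zeros up to \<open>s * s\<close> makes all blocks full. In addition
    \<open>y'\<close> drops the large coordinates, whose exponentials are merely bounded by
    1.\<close>
  define y where "y i = (if i < n then \<bar>x i\<bar> else 0)" for i
  define y' where "y' i = (if s * y i \<le> X then y i else 0)" for i
  define \<mu> where "\<mu> = (\<Sum>i<s * s. y' i)"
  have y'0: "0 \<le> y' i" for i by (simp add: y'_def y_def)
  have \<mu>: "\<mu> = (\<Sum>i | i < n \<and> s * \<bar>x i\<bar> \<le> l1 n x. \<bar>x i\<bar>)"
    unfolding \<mu>_def y'_def y_def X_def using s(2)
    by (intro sum.mono_neutral_cong_right) (auto split: if_splits)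
  have "\<mu> \<le> X"
    unfolding \<mu> unfolding X_def l1_def by (intro sum_mono2) auto
  have "\<mu> / (2 * X) / 2 \<le> 1 - exp (- (\<mu> / (2 * X)))"
    using \<open>\<mu> \<le> X\<close> X0 y'0 by (intro one_minus_exp_ge) (auto simp: \<mu>_def intro!: sum_nonneg divide_nonneg_nonneg)
  then have "X * (\<mu> / (2 * X) / 2) \<le> X * (1 - exp (- (\<mu> / (2 * X))))"
    using X0 by (intro mult_left_mono) auto
  then have "\<mu> / 4 \<le> X * (1 - exp (- (\<mu> / (2 * X))))" using X0 by simp
  also have "\<dots> \<le> X * (1 - expect ?R (\<lambda>r. \<Prod>v<s. exp (- (s * y (v * s + r v) / X))))"
  proof -
    have "expect ?R (\<lambda>r. \<Prod>v<s. exp (- (s * y (v * s + r v) / X)))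
        = (\<Prod>v<s. expect (pmf_of_set {..<s}) (\<lambda>r. exp (- (s * y (v * s + r) / X))))"
      using s by (intro expectation_prod_Pi_pmf) (auto intro!: integrable_measure_pmf_finite)
    also have "\<dots> \<le> (\<Prod>v<s. exp (- (\<Sum>r<s. y' (v * s + r)) / (2 * X)))"
    proof (intro prod_mono conjI)
      fix v
      have one: "exp (- (s * y i / X)) \<le> 1 - s * y' i / X / 2" for i
      proof (cases "s * y i \<le> X")
        case True
        then have "s * y i / X / 2 \<le> 1 - exp (- (s * y i / X))"
          using X0 by (intro one_minus_exp_ge) (auto simp: y_def)
        then show ?thesis using True by (simp add: y'_def)
      next
        case False
        then show ?thesis using X0 by (simp add: y'_def y_def)
      qed
      have "expect (pmf_of_set {..<s}) (\<lambda>r. exp (- (s * y (v * s + r) / X)))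
          \<le> expect (pmf_of_set {..<s}) (\<lambda>r. 1 - s * y' (v * s + r) / X / 2)"
        using s by (intro expect_mono one) auto
      also have "\<dots> = 1 + - (\<Sum>r<s. y' (v * s + r)) / (2 * X)"
        using s X0 by (simp add: expect_uniform sum_subtractf sum_divide_distrib[symmetric]
            sum_distrib_left[symmetric] field_simps)
      also have "\<dots> \<le> exp (- (\<Sum>r<s. y' (v * s + r)) / (2 * X))" by (rule exp_ge_add_one_self)
      finally show "expect (pmf_of_set {..<s}) (\<lambda>r. exp (- (s * y (v * s + r) / X))) \<le> \<dots>" .
    qed (auto intro!: Bochner_Integration.integral_nonneg)
    also have "\<dots> = exp (- (\<mu> / (2 * X)))"
      unfolding \<mu>_def sum_lessThan_mult
      by (simp add: exp_sum[symmetric] sum_negf sum_divide_distrib)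
    finally show ?thesis using X0 by (intro mult_left_mono) auto
  qed
  also have "\<dots> = expect ?R (\<lambda>r. X + (- X) * (\<Prod>v<s. exp (- (s * y (v * s + r v) / X))))"
    by (subst expect_add[OF finR]) (simp add: algebra_simps)
  also have "\<dots> \<le> expect ?R (\<lambda>r. min (l1 (2 * s) (sk_apply n
      (\<lambda>i. i div s, \<lambda>i. if i mod s = r (i div s) then real s else 0) x)) X)"
  proof (intro expect_mono finR)
    fix r assume r: "r \<in> set_pmf ?R"
    have r_lt: "r v < s" if "v < s" for v
      using r that s by (auto simp: set_Pi_pmf PiE_dflt_def)
    define u where "u = (\<Sum>v<s. s * y (v * s + r v))"
    have "u = (\<Sum>v<s. \<bar>sk_apply n (\<lambda>i. i div s, \<lambda>i. if i mod s = r (i div s) then real s else 0) x v\<bar>)"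
      unfolding u_def by (intro sum.cong refl) (simp add: sample_sketch_apply r_lt y_def abs_mult)
    also have "\<dots> \<le> l1 (2 * s) (sk_apply n (\<lambda>i. i div s, \<lambda>i. if i mod s = r (i div s) then real s else 0) x)"
      unfolding l1_def by (intro sum_mono2) auto
    finally have u: "u \<le> \<dots>" .
    have "(\<Prod>v<s. exp (- (s * y (v * s + r v) / X))) = exp (- (u / X))"
      unfolding u_def by (simp add: exp_sum[symmetric] sum_negf sum_divide_distrib)
    moreover have "1 - u / X \<le> exp (- (u / X))" using exp_ge_add_one_self[of "- (u / X)"] by simp
    then have "X * (1 - u / X) \<le> X * exp (- (u / X))" using X0 by (intro mult_left_mono) auto
    then have "X + - X * exp (- (u / X)) \<le> u" using X0 by (simp add: algebra_simps)
    moreover have "X + - X * exp (- (u / X)) \<le> X" using X0 by simp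
    ultimately show "X + - X * (\<Prod>v<s. exp (- (s * y (v * s + r v) / X))) \<le> min (l1 (2 * s) (sk_apply n
      (\<lambda>i. i div s, \<lambda>i. if i mod s = r (i div s) then real s else 0) x)) X"
      using u by simp
  qed
  also have "\<dots> = expect (sample_sketch s) (\<lambda>T. min (l1 (2 * s) (sk_apply n T x)) (l1 n x))"
    by (simp add: sample_sketch_def X_def)
  finally show ?thesis unfolding \<mu> .
qed

text \<open>The hashed half of the mixture preserves the mass of the coordinates above \<open>l1 n x / s\<close>, of
  which there are at most \<open>s\<close>; the sampled half preserves the mass of the remaining ones.\<close>

definition sqrt_sketch :: "nat \<Rightarrow> nat \<Rightarrow> sketch pmf" where
  "sqrt_sketch n s = bind_pmf (bernoulli_pmf (1/2))
     (\<lambda>b. if b then hash_sketch n (2 * s) else sample_sketch s)"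

text \<open>Each half is chosen with probability one half and keeps a quarter of its share of the
  mass, which gives \<open>1 / 8\<close>. The columns have mean absolute entry 1: hashed entries are
  signs, and a sampled entry equals \<open>s\<close> with probability \<open>1 / s\<close>.\<close>

lemma l1_sketch_sqrt:
  assumes s: "0 < s" "n \<le> s * s"
  shows "l1_sketch n (2 * s) (1 / 8) (sqrt_sketch n s)"
  unfolding l1_sketch_def
proof (intro conjI ballI allI impI)
  have finH: "finite (set_pmf (hash_sketch n (2 * s)))"
    unfolding hash_sketch_def using s by (auto intro!: finite_set_Pi_pmf)
  have finS: "finite (set_pmf (sample_sketch s))"
    unfolding sample_sketch_def using s by (auto intro!: finite_set_Pi_pmf)
  show "finite (set_pmf (sqrt_sketch n s))"
    unfolding sqrt_sketch_def using finH finS by (intro finite_set_bind_pmf) auto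
  have E: "expect (sqrt_sketch n s) f = (expect (hash_sketch n (2 * s)) f + expect (sample_sketch s) f) / 2" for f
    unfolding sqrt_sketch_def using finH finS by (subst expect_bind) auto
  have div: "i div s < s" if "i < n" for i
    using that s by (intro less_mult_imp_div_less) linarith
  show "sk_into n (2 * s) T" if T: "T \<in> set_pmf (sqrt_sketch n s)" for T
  proof -
    consider "T \<in> set_pmf (hash_sketch n (2 * s))" | "T \<in> set_pmf (sample_sketch s)"
      using T by (auto simp: sqrt_sketch_def set_bind_pmf split: if_splits)
    then show ?thesis
    proof cases
      case 1
      then show ?thesis using s
        by (auto simp: hash_sketch_def sk_into_def set_Pi_pmf PiE_dflt_def)
    next
      case 2
      then show ?thesis using div by (fastforce simp: sample_sketch_def sk_into_def)
    qed
  qed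
  show "expect (sqrt_sketch n s) (\<lambda>T. \<bar>snd T i\<bar>) \<le> 1" if i: "i < n" for i
  proof -
    have "expect (hash_sketch n (2 * s)) (\<lambda>T. \<bar>snd T i\<bar>) = expect random_sign abs"
      unfolding hash_sketch_def using s i
      by (simp add: expect_pair_pmf finite_set_Pi_pmf expect_Pi_pmf_component)
    moreover have "expect (sample_sketch s) (\<lambda>T. \<bar>snd T i\<bar>)
        = expect (pmf_of_set {..<s}) (\<lambda>r. \<bar>if i mod s = r then real s else 0\<bar>)"
      unfolding sample_sketch_def integral_map_pmf snd_conv
      using div[OF i] by (subst expect_Pi_pmf_component[symmetric, of "{..<s}" "i div s"]) auto
    moreover have "\<dots> = 1"
      using s by (simp add: expect_uniform if_distrib[of abs] cong: if_cong)
    ultimately show ?thesis by (simp add: E expect_random_sign)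
  qed
  fix x
  show "1 / 8 * l1 n x \<le> expect (sqrt_sketch n s) (\<lambda>T. min (l1 (2 * s) (sk_apply n T x)) (l1 n x))"
  proof (cases "l1 n x = 0")
    case True
    then show ?thesis by (auto intro!: Bochner_Integration.integral_nonneg)
  next
    case False
    then have X: "0 < l1 n x" using l1_nonneg[of n x] by linarith
    let ?L = "{i. i < n \<and> l1 n x < s * \<bar>x i\<bar>}"
    let ?S = "{i. i < n \<and> s * \<bar>x i\<bar> \<le> l1 n x}"
    have "card ?L * l1 n x = (\<Sum>i\<in>?L. l1 n x)" by simp
    also have "\<dots> \<le> (\<Sum>i\<in>?L. s * \<bar>x i\<bar>)" by (intro sum_mono) auto
    also have "\<dots> \<le> (\<Sum>i<n. s * \<bar>x i\<bar>)" by (intro sum_mono2) auto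
    also have "\<dots> = s * l1 n x" by (simp add: l1_def sum_distrib_left)
    finally have "card ?L \<le> s" using X by simp
    then have 1: "(\<Sum>i\<in>?L. \<bar>x i\<bar>) / 4
        \<le> expect (hash_sketch n (2 * s)) (\<lambda>T. min (l1 (2 * s) (sk_apply n T x)) (l1 n x))"
      using s by (intro hash_sketch_lower) auto
    note 2 = sample_sketch_lower[OF s X]
    have eq: "(\<Sum>i\<in>?L. \<bar>x i\<bar>) + (\<Sum>i\<in>?S. \<bar>x i\<bar>) = l1 n x"
      unfolding l1_def by (subst sum.union_disjoint[symmetric]) (auto intro!: sum.cong)
    have "1 / 8 * z \<le> (P + Q) / 2" if "a / 4 \<le> P" "b / 4 \<le> Q" "a + b = z" for a b z P Q :: real
      using that by (simp add: field_simps)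
    from this[OF 1 2 eq] show ?thesis unfolding E .
  qed
qed

section \<open>Iteration to the fourth root\<close>

lemma ex_square_between:
  assumes "1 \<le> n"
  shows "\<exists>s>0. n \<le> s * s \<and> s * s \<le> 4 * (n :: nat)"
proof -
  define s where "s = (LEAST s. n \<le> s * s)"
  have s: "n \<le> s * s" unfolding s_def by (rule LeastI[of _ n]) simp
  have "\<not> n \<le> (s - 1) * (s - 1)" if "0 < s"
    using that not_less_Least[of "s - 1" "\<lambda>s. n \<le> s * s"] by (simp add: s_def)
  moreover have s0: "0 < s" using s assms by (cases s) auto
  ultimately have lt: "(s - 1) * (s - 1) < n" by simp
  have "s * s \<le> 4 * n"
  proof (cases "s = 1")
    case False
    then have "s \<le> 2 * (s - 1)" using s0 by simp
    then have "s * s \<le> 2 * (s - 1) * (2 * (s - 1))" by (intro mult_mono) auto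
    then show ?thesis using lt by simp
  qed (use assms in simp)
  then show ?thesis using s s0 by blast
qed

text \<open>Two square-root steps: \<open>1 / 64\<close> is \<open>(1 / 8)\<^sup>2\<close>, and
  \<open>s * s \<le> 4 * q\<close> together with \<open>r * r \<le> 8 * s\<close> gives
  \<open>(2 * r) ^ 4 \<le> 1024 * (s * s) \<le> 4096 * q\<close>.\<close>

lemma ex_l1_sketch_fourth_root:
  assumes "1 \<le> q"
  obtains d p where "l1_sketch q d (1 / 64) p" "d ^ 4 \<le> 4096 * q"
proof -
  obtain s where s: "0 < s" "q \<le> s * s" "s * s \<le> 4 * q" using ex_square_between[OF assms] by blast
  then have "1 \<le> 2 * s" by simp
  then obtain r where r: "0 < r" "2 * s \<le> r * r" "r * r \<le> 4 * (2 * s)" using ex_square_between by blast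
  have "l1_sketch q (2 * r) (1 / 8 * (1 / 8))
      (bind_pmf (sqrt_sketch q s) (\<lambda>T. map_pmf (\<lambda>U. sk_comp U T) (sqrt_sketch (2 * s) r)))"
    by (rule l1_sketch_comp[OF l1_sketch_sqrt l1_sketch_sqrt]) (use s r in auto)
  moreover have "(2 * r) ^ 4 = 16 * ((r * r) * (r * r))" by (simp add: power4_eq_xxxx)
  moreover have "16 * ((r * r) * (r * r)) \<le> 16 * (4 * (2 * s) * (4 * (2 * s)))"
    by (intro mult_le_mono2 mult_le_mono r(3))
  moreover have "16 * (4 * (2 * s) * (4 * (2 * s))) = 1024 * (s * s)" by simp
  moreover have "1024 * (s * s) \<le> 1024 * (4 * q)" by (intro mult_le_mono2 s(3))
  ultimately show thesis using r(1) by (intro that[of "2 * r"]) auto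
qed

section \<open>Tensor powers\<close>

lemma sk_kron_assoc:
  assumes "0 < n3"
  shows "sk_kron n3 d3 (sk_kron n2 d2 A B) C = sk_kron (n2 * n3) (d2 * d3) A (sk_kron n3 d3 B C)"
proof -
  have "i div (n2 * n3) = i div n3 div n2" "i mod (n2 * n3) div n3 = i div n3 mod n2"
    "i mod (n2 * n3) mod n3 = i mod n3" for i
    using assms by (simp_all add: div_mult2_eq mod_mult2_eq mult.commute[of n2])
  then show ?thesis by (simp add: sk_kron_def algebra_simps)
qed

primrec sk_krons :: "nat \<Rightarrow> nat \<Rightarrow> sketch list \<Rightarrow> sketch" where
  "sk_krons n d [] = (\<lambda>_. 0, \<lambda>_. 1)"
| "sk_krons n d (T # Ts) = sk_kron (n ^ length Ts) (d ^ length Ts) T (sk_krons n d Ts)"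

text \<open>Allows one list of factors to be cut into two or three groups. The equation concerns all
  indices, also those out of range, where an empty left part would insert a reduction modulo the
  dimension belonging to \<open>ys\<close>; hence \<open>xs \<noteq> []\<close>.\<close>

lemma sk_krons_append:
  assumes "xs \<noteq> []" "0 < n"
  shows "sk_krons n d (xs @ ys)
    = sk_kron (n ^ length ys) (d ^ length ys) (sk_krons n d xs) (sk_krons n d ys)"
  using assms(1)
proof (induction xs rule: list_nonempty_induct)
  case (single x)
  show ?case by (simp add: sk_kron_def)
next
  case (cons x xs)
  then show ?case using assms(2) by (simp add: sk_kron_assoc power_add)
qed

lemma sk_into_krons:
  "(\<And>T. T \<in> set Ts \<Longrightarrow> sk_into n d T) \<Longrightarrow> sk_into (n ^ length Ts) (d ^ length Ts) (sk_krons n d Ts)"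
proof (induction Ts)
  case Nil
  then show ?case by (simp add: sk_into_def)
next
  case (Cons T Ts)
  then show ?case using sk_into_kron[of n d T "n ^ length Ts" "d ^ length Ts" "sk_krons n d Ts"] by simp
qed

primrec iid_list :: "nat \<Rightarrow> 'a pmf \<Rightarrow> 'a list pmf" where
  "iid_list 0 p = return_pmf []"
| "iid_list (Suc L) p = bind_pmf (iid_list L p) (\<lambda>xs. map_pmf (\<lambda>x. x # xs) p)"

lemma set_iid_list: "xs \<in> set_pmf (iid_list L p) \<Longrightarrow> length xs = L \<and> set xs \<subseteq> set_pmf p"
  by (induction L arbitrary: xs) (fastforce simp: set_bind_pmf)+

lemma l1_sketch_krons:
  assumes "l1_sketch n d c p" "0 \<le> c"
  shows "l1_sketch (n ^ L) (d ^ L) (c ^ L) (map_pmf (sk_krons n d) (iid_list L p))"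
proof (induction L)
  case 0
  show ?case
    by (simp add: l1_sketch_def sk_into_def l1_def sk_apply_def)
next
  case (Suc L)
  have "map_pmf (sk_krons n d) (iid_list (Suc L) p)
      = bind_pmf (iid_list L p) (\<lambda>Ts. map_pmf (\<lambda>T. sk_kron (n ^ L) (d ^ L) T (sk_krons n d Ts)) p)"
    by (auto simp: map_bind_pmf pmf.map_comp o_def dest!: set_iid_list intro!: bind_pmf_cong map_pmf_cong)
  also have "\<dots> = bind_pmf (map_pmf (sk_krons n d) (iid_list L p))
      (\<lambda>T'. map_pmf (\<lambda>T. sk_kron (n ^ L) (d ^ L) T T') p)"
    by (simp add: bind_map_pmf)
  finally show ?case
    using l1_sketch_kron[OF assms(1) Suc assms(2)] by simp
qed

section \<open>Random rows\<close>

lemma l1_sketch_weaken: "l1_sketch n d c p \<Longrightarrow> c' \<le> c \<Longrightarrow> l1_sketch n d c' p"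
  unfolding l1_sketch_def by (meson l1_nonneg mult_right_mono order_trans)

definition random_row :: "sketch pmf \<Rightarrow> nat \<Rightarrow> nat \<Rightarrow> (nat \<Rightarrow> real) pmf" where
  "random_row q d J = bind_pmf q (\<lambda>V. map_pmf (sk_row V) (Pi_pmf {..<d} 0 (\<lambda>_. heavy_weight J)))"

text \<open>For fixed \<open>V\<close> both estimates are linear in the norm of the sketched vector,
  truncated at \<open>l1 n x\<close> for the lower one, so the expectations in
  \<open>l1_sketch\<close> finish the proof. Half of the lower bound is spent on
  \<open>\<theta>\<close>, which with the 8 of \<open>heavy_form_lower_l1\<close> gives
  \<open>c / 16\<close>. The condition on \<open>J\<close> is what that lemma requires at the top
  level \<open>2 ^ g * l1 n x\<close>.\<close>

lemma cauchy_like_random_row: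
  assumes q: "l1_sketch n d c q" and c: "0 < c" and X: "0 < l1 n x" and g: "0 < g"
    and J: "2 * real d * 2 ^ g \<le> c * 2 ^ J"
  shows "cauchy_like (random_row q d J) (\<lambda>r. \<Sum>j<n. r j * x j) (l1 n x) (c / 16) g"
proof
  note qD = l1_sketchD[OF q]
  let ?W = "Pi_pmf {..<d} 0 (\<lambda>_. heavy_weight J)"
  let ?X = "l1 n x"
  have finW: "finite (set_pmf ?W)" by (intro finite_set_Pi_pmf) auto
  show "finite (set_pmf (random_row q d J))"
    unfolding random_row_def using qD(1) finW by (intro finite_set_bind_pmf) auto
  have E: "expect (random_row q d J) (\<lambda>r. f (\<Sum>j<n. r j * x j))
      = expect q (\<lambda>V. expect ?W (\<lambda>w. f (\<Sum>v<d. w v * sk_apply n V x v)))" for f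
    unfolding random_row_def using qD(1) finW
    by (subst expect_bind) (auto intro!: expect_cong simp: sum_sk_row[OF qD(2)])
  show "expect (random_row q d J) (\<lambda>r. min ((\<Sum>j<n. r j * x j)\<^sup>2) (t\<^sup>2)) \<le> 3 / 2 * t * ?X"
    if t: "0 < t" for t
  proof -
    have "expect (random_row q d J) (\<lambda>r. min ((\<Sum>j<n. r j * x j)\<^sup>2) (t\<^sup>2))
        \<le> expect q (\<lambda>V. 3 / 2 * t * l1 d (sk_apply n V x))"
      unfolding E[of "\<lambda>u. min (u\<^sup>2) (t\<^sup>2)"]
      using heavy_form_truncated_square[of "{..<d}" t J 0] t
      by (intro expect_mono qD(1)) (auto simp: l1_def)
    also have "\<dots> \<le> 3 / 2 * t * ?X"
      using l1_sketch_expect_le[OF q, of x] t by simp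
    finally show ?thesis .
  qed
  show "c / 16 * ?X / t \<le> expect (random_row q d J) (\<lambda>r. of_bool (t \<le> \<bar>\<Sum>j<n. r j * x j\<bar>))"
    if t: "?X \<le> t" "t \<le> 2 ^ g * ?X" for t
  proof -
    define \<theta> where "\<theta> = c * ?X / 2"
    have t0: "0 < t" using X t by linarith
    have "real d * t \<le> real d * (2 ^ g * ?X)" using t by (intro mult_left_mono) auto
    also have "\<dots> \<le> \<theta> * 2 ^ J"
      using mult_right_mono[OF J, of "?X / 2"] X by (simp add: \<theta>_def mult_ac)
    finally have le: "real d * t \<le> \<theta> * 2 ^ J" .
    have "c * ?X \<le> expect q (\<lambda>V. min (l1 d (sk_apply n V x)) ?X)" by (rule qD(4))
    then have "(c * ?X - \<theta>) / (8 * t) \<le> (expect q (\<lambda>V. min (l1 d (sk_apply n V x)) ?X) - \<theta>) / (8 * t)"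
      using t0 by (intro divide_right_mono diff_right_mono) auto
    also have "\<dots> = expect q (\<lambda>V. (min (l1 d (sk_apply n V x)) ?X - \<theta>) / (8 * t))"
      using qD(1) expect_add[OF qD(1), of "\<lambda>V. min (l1 d (sk_apply n V x)) ?X" "\<lambda>_. - \<theta>"] by simp
    also have "\<dots> \<le> expect (random_row q d J) (\<lambda>r. of_bool (t \<le> \<bar>\<Sum>j<n. r j * x j\<bar>))"
      unfolding E[of "\<lambda>u. of_bool (t \<le> \<bar>u\<bar>)"]
      using X c t le by (intro expect_mono qD(1) heavy_form_lower_l1) (auto simp: \<theta>_def)
    finally show ?thesis using t0 by (simp add: \<theta>_def)
  qed
qed (use X c g in auto)

section \<open>The random matrix\<close>

definition row_matrix :: "nat \<Rightarrow> nat \<Rightarrow> real \<Rightarrow> (nat \<Rightarrow> nat \<Rightarrow> real) \<Rightarrow> real mat" where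
  "row_matrix m n s f = mat m n (\<lambda>(i, j). s * f i j)"

text \<open>The discrete sigma-algebra makes every event measurable, and almost-sure claims reduce
  to the support of the rows.\<close>

definition matrix_measure :: "nat \<Rightarrow> nat \<Rightarrow> real \<Rightarrow> (nat \<Rightarrow> real) pmf \<Rightarrow> real mat measure" where
  "matrix_measure m n s \<rho> =
     distr (measure_pmf (Pi_pmf {..<m} (\<lambda>_. 0) (\<lambda>_. \<rho>))) (count_space (carrier_mat m n)) (row_matrix m n s)"

lemma row_matrix_measurable:
  "row_matrix m n s \<in> measurable (measure_pmf P) (count_space (carrier_mat m n))"
  by (auto simp: row_matrix_def measurable_pmf_measure1)

lemma linear_map_distribution_matrix_measure:
  "linear_map_distribution m n (matrix_measure m n s \<rho>)"
  unfolding linear_map_distribution_def matrix_measure_def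
  by (auto intro!: prob_space.prob_space_distr row_matrix_measurable measurable_count_space_eq1
      simp: measure_pmf.prob_space_axioms)

lemma prob_matrix_measure:
  "measure (matrix_measure m n s \<rho>) {S \<in> space (matrix_measure m n s \<rho>). P S}
   = measure_pmf.prob (Pi_pmf {..<m} (\<lambda>_. 0) (\<lambda>_. \<rho>)) {f. P (row_matrix m n s f)}"
proof -
  have "{S \<in> space (matrix_measure m n s \<rho>). P S} = {S \<in> carrier_mat m n. P S}"
    by (simp add: matrix_measure_def)
  moreover have "row_matrix m n s f \<in> carrier_mat m n" for f by (simp add: row_matrix_def)
  ultimately show ?thesis
    unfolding matrix_measure_def
    by (simp add: measure_distr[OF row_matrix_measurable] vimage_def)
qed

lemma AE_matrix_measureI:
  assumes "\<And>f. f \<in> set_pmf (Pi_pmf {..<m} (\<lambda>_. 0) (\<lambda>_. \<rho>)) \<Longrightarrow> P (row_matrix m n s f)"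
  shows "AE S in matrix_measure m n s \<rho>. P S"
  unfolding matrix_measure_def using assms
  by (subst AE_distr_iff[OF row_matrix_measurable]) (auto simp: AE_measure_pmf_iff)

lemma l1_norm_row_matrix:
  assumes "x \<in> carrier_vec n" "0 \<le> s"
  shows "l1_norm_vec (row_matrix m n s f *\<^sub>v x) = (\<Sum>i<m. \<bar>\<Sum>j<n. f i j * x $ j\<bar>) * s"
proof -
  have "l1_norm_vec (row_matrix m n s f *\<^sub>v x) = (\<Sum>i<m. \<bar>\<Sum>j<n. s * f i j * x $ j\<bar>)"
    using assms(1) by (auto simp: l1_norm_vec_def row_matrix_def scalar_prod_def lessThan_atLeast0 intro!: sum.cong)
  also have "\<dots> = (\<Sum>i<m. \<bar>\<Sum>j<n. f i j * x $ j\<bar> * s)"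
    using assms(2) by (simp only: mult.assoc sum_distrib_left[symmetric] abs_mult) (simp add: mult.commute sum_distrib_left)
  finally show ?thesis by (simp add: sum_distrib_right)
qed

text \<open>If \<open>n\<close> is both a square and a cube, it is a sixth power, and then the same tensor power
  must serve both factorizations.\<close>

lemma ex_tensor_order:
  assumes "1 \<le> (n::nat)"
  obtains q L where "1 \<le> q" "q ^ L = n" "L \<le> 6"
    "\<forall>k. n = k ^ 2 \<longrightarrow> (\<exists>e. 1 \<le> e \<and> e \<le> 3 \<and> L = 2 * e \<and> k = q ^ e)"
    "\<forall>k. n = k ^ 3 \<longrightarrow> (\<exists>e. 1 \<le> e \<and> e \<le> 3 \<and> L = 3 * e \<and> k = q ^ e)"
proof -
  have root: "a = b" if "a ^ e = b ^ e" "0 < e" for a b e :: nat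
    using that power_eq_imp_eq_base[of a e b] by simp
  have pos: "1 \<le> q" if "q ^ L = n" "0 < L" for q L
    using that assms by (cases q) (auto simp: zero_power)
  \<comment> \<open>From \<open>a ^ 2 = b ^ 3\<close> it follows that \<open>b\<close> divides
    \<open>a\<close>; writing \<open>a = b * r\<close> yields \<open>b = r ^ 2\<close> and
    \<open>n = r ^ 6\<close>.\<close>
  have sixth: "\<exists>r. n = r ^ 6" if "n = a ^ 2" "n = b ^ 3" for a b
  proof -
    have "b ^ 2 dvd a ^ 2" using that by (metis dvd_triv_right power3_eq_cube power2_eq_square mult.assoc dvd_triv_left)
    then have "b dvd a" by (simp add: pow_divides_pow_iff)
    then obtain r where a: "a = b * r" by blast
    have "b \<noteq> 0" using that assms by (cases "b = 0") auto
    have "b ^ 2 * r ^ 2 = b ^ 2 * b" using that a by (auto simp: power_mult_distrib power3_eq_cube power2_eq_square)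
    then have "b = r ^ 2" using \<open>b \<noteq> 0\<close> by (metis mult_left_cancel power_not_zero)
    then have "n = r ^ 6" using that by (simp flip: power_mult)
    then show ?thesis by blast
  qed
  consider r where "n = r ^ 6" | a where "n = a ^ 2" "\<nexists>b. n = b ^ 3" | b where "n = b ^ 3" "\<nexists>a. n = a ^ 2"
    | "\<nexists>a. n = a ^ 2" "\<nexists>b. n = b ^ 3"
    using sixth by blast
  then show thesis
  proof cases
    case 1
    show thesis
    proof (rule that[of r 6])
      show "\<forall>k. n = k ^ 2 \<longrightarrow> (\<exists>e. 1 \<le> e \<and> e \<le> 3 \<and> 6 = 2 * e \<and> k = r ^ e)"
      proof (intro allI impI)
        fix k assume that: "n = k ^ 2"
        have "k ^ 2 = (r ^ 3) ^ 2" using that 1 by (simp flip: power_mult)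
        from root[OF this] show "\<exists>e. 1 \<le> e \<and> e \<le> 3 \<and> 6 = 2 * e \<and> k = r ^ e" by (intro exI[of _ 3]) auto
      qed
      show "\<forall>k. n = k ^ 3 \<longrightarrow> (\<exists>e. 1 \<le> e \<and> e \<le> 3 \<and> 6 = 3 * e \<and> k = r ^ e)"
      proof (intro allI impI)
        fix k assume that: "n = k ^ 3"
        have "k ^ 3 = (r ^ 2) ^ 3" using that 1 by (simp flip: power_mult)
        from root[OF this] show "\<exists>e. 1 \<le> e \<and> e \<le> 3 \<and> 6 = 3 * e \<and> k = r ^ e" by (intro exI[of _ 2]) auto
      qed
    qed (use 1 pos[of r 6] in auto)
  next
    case 2
    show thesis
      by (rule that[of a 2]) (use 2 pos[of a 2] root[of _ 2 a] in \<open>auto intro!: exI[of _ 1]\<close>)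
  next
    case 3
    show thesis
      by (rule that[of b 3]) (use 3 pos[of b 3] root[of _ 3 b] in \<open>auto intro!: exI[of _ 1]\<close>)
  next
    case 4
    \<comment> \<open>No running time is demanded for such \<open>n\<close>, so a single factor
      does.\<close>
    show thesis by (rule that[of n 1]) (use 4 assms in auto)
  qed
qed

text \<open>Minimality of \<open>g\<close> bounds \<open>2 ^ (g - 1)\<close> by \<open>u\<close>,
  except when \<open>g = 1\<close>, which the summand 4 covers. A positive \<open>g\<close> is
  required because the norms are divided by it.\<close>

lemma ex_row_count:
  assumes "0 \<le> (u::real)"
  obtains g :: nat where "0 < g" "u \<le> 2 ^ g" "4 ^ g \<le> 4 + 4 * u\<^sup>2"
proof -
  let ?P = "\<lambda>g::nat. 0 < g \<and> u \<le> 2 ^ g"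
  define g where "g = (LEAST g. ?P g)"
  obtain N :: nat where N: "u < 2 ^ N" using real_arch_pow[of 2 u] by auto
  then have "u \<le> 2 ^ Suc N" by (smt (verit) power_increasing le_SucI order_refl one_le_numeral lessI less_imp_le)
  then have g: "0 < g" "u \<le> 2 ^ g" unfolding g_def using LeastI[of ?P "Suc N"] by auto
  have "(4::real) ^ g \<le> 4 + 4 * u\<^sup>2"
  proof (cases "g = 1")
    case False
    then have "\<not> ?P (g - 1)" using g not_less_Least[of "g - 1" ?P] by (simp add: g_def)
    then have "2 ^ (g - 1) \<le> u" using False g by auto
    then have "(2 ^ (g - 1))\<^sup>2 \<le> u\<^sup>2" by (intro power_mono) auto
    moreover have "(4::real) ^ g = 4 * (2 ^ (g - 1))\<^sup>2"
      using g(1) by (cases g) (auto simp: power_mult[symmetric] power2_eq_square power_mult_distrib[symmetric])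
    ultimately show ?thesis by simp
  qed simp
  with g show thesis by (rule that)
qed

text \<open>As \<open>D\<close> is at most of order \<open>k ^ (1/4)\<close>, all its powers up to
  the fourth are at most linear in \<open>k\<close>. The larger coefficient sums are
  \<open>9 + 1\<close> for \<open>k\<close> and \<open>3 + 1 + 4\<close> for
  \<open>D ^ 4\<close>.\<close>

lemma program_length_bound:
  assumes "d ^ 4 \<le> 4096 * q" "k = q ^ e" "D = d ^ e" "1 \<le> e" "e \<le> 3" "1 \<le> (q::nat)"
  shows "6 * k + 2 * D + 4 * D\<^sup>2 + 1 \<le> (10 + 8 * 4096 ^ 3) * k"
    and "9 * k + 3 * D + D\<^sup>2 + 4 * D ^ 3 + 1 \<le> (10 + 8 * 4096 ^ 3) * k"
proof -
  have "D ^ 4 = (d ^ 4) ^ e" using assms by (simp flip: power_mult add: mult.commute)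
  also have "\<dots> \<le> (4096 * q) ^ e" using assms by (intro power_mono) auto
  also have "\<dots> = 4096 ^ e * k" using assms by (simp add: power_mult_distrib)
  also have "\<dots> \<le> 4096 ^ 3 * k" using assms by (intro mult_le_mono1 power_increasing) auto
  finally have D4: "D ^ 4 \<le> 4096 ^ 3 * k" .
  have D: "D ^ j \<le> D ^ 4" if "1 \<le> j" "j \<le> 4" for j
    using that by (cases "D = 0") (auto intro!: power_increasing simp: Suc_le_eq)
  have "1 \<le> k" using assms by (simp add: Suc_le_eq)
  then show "6 * k + 2 * D + 4 * D\<^sup>2 + 1 \<le> (10 + 8 * 4096 ^ 3) * k"
    "9 * k + 3 * D + D\<^sup>2 + 4 * D ^ 3 + 1 \<le> (10 + 8 * 4096 ^ 3) * k"
    using D4 D[of 1] D[of 2] D[of 3] by simp_all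
qed

lemma applies_to_rank_one_within_mono:
  "applies_to_rank_one2_within S k t \<Longrightarrow> t \<le> t' \<Longrightarrow> applies_to_rank_one2_within S k t'"
  "applies_to_rank_one3_within S k t \<Longrightarrow> t \<le> t' \<Longrightarrow> applies_to_rank_one3_within S k t'"
  unfolding applies_to_rank_one2_within_def applies_to_rank_one3_within_def
  by (meson order_trans)+

text \<open>All that the running time depends on: the shape of a row, irrespective of its law. Every
  row in the support has it, so the bounds hold almost surely.\<close>

definition tensor_rows :: "nat \<Rightarrow> nat \<Rightarrow> nat \<Rightarrow> (nat \<Rightarrow> real) set" where
  "tensor_rows q d L = {sk_row (sk_krons q d Ts) w | Ts w. length Ts = L \<and> (\<forall>T\<in>set Ts. sk_into q d T)}"

lemma set_random_row_krons:
  assumes "l1_sketch q d c p"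
  shows "set_pmf (random_row (map_pmf (sk_krons q d) (iid_list L p)) D J) \<subseteq> tensor_rows q d L"
  using l1_sketchD(2)[OF assms]
  by (fastforce simp: random_row_def set_bind_pmf tensor_rows_def dest!: set_iid_list)

lemma tensor_rows_apply2:
  assumes f: "\<And>i. i < m \<Longrightarrow> f i \<in> tensor_rows q d (2 * e)" and e: "1 \<le> e" and q: "1 \<le> q"
    and k: "k = q ^ e" and D: "D = d ^ e"
  shows "applies_to_rank_one2_within (row_matrix m (k * k) s f) k
           (real (m * (6 * k + 2 * D + 4 * D\<^sup>2 + 1)))"
proof (rule applies_to_rank_one2I[where s = s])
  fix i assume i: "i < m"
  then obtain Ts w where Ts: "f i = sk_row (sk_krons q d Ts) w" "length Ts = 2 * e"
    "\<And>T. T \<in> set Ts \<Longrightarrow> sk_into q d T"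
    using f[OF i] by (auto simp: tensor_rows_def)
  define A where "A = take e Ts"
  define B where "B = drop e Ts"
  have AB: "Ts = A @ B" "length A = e" "length B = e" using Ts(2) by (auto simp: A_def B_def)
  have "A \<noteq> []" using AB(2) e by auto
  then have "sk_krons q d Ts = sk_kron k D (sk_krons q d A) (sk_krons q d B)"
    using q AB by (simp add: sk_krons_append k D)
  moreover have "sk_into k D (sk_krons q d A)" "sk_into k D (sk_krons q d B)"
    using sk_into_krons[of A q d] sk_into_krons[of B q d] Ts(3) AB by (auto simp: k D)
  ultimately show "\<exists>T1 T2 w. sk_into k D T1 \<and> sk_into k D T2 \<and>
      (\<forall>j<k * k. row_matrix m (k * k) s f $$ (i, j) = s * sk_row (sk_kron k D T1 T2) w j)"
    using i Ts(1)
    by (intro exI[of _ "sk_krons q d A"] exI[of _ "sk_krons q d B"] exI[of _ w]) (simp add: row_matrix_def)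
qed (simp add: row_matrix_def)

lemma tensor_rows_apply3:
  assumes f: "\<And>i. i < m \<Longrightarrow> f i \<in> tensor_rows q d (3 * e)" and e: "1 \<le> e" and q: "1 \<le> q"
    and k: "k = q ^ e" and D: "D = d ^ e"
  shows "applies_to_rank_one3_within (row_matrix m (k * k * k) s f) k
           (real (m * (9 * k + 3 * D + D\<^sup>2 + 4 * D ^ 3 + 1)))"
proof (rule applies_to_rank_one3I[where s = s])
  fix i assume i: "i < m"
  then obtain Ts w where Ts: "f i = sk_row (sk_krons q d Ts) w" "length Ts = 3 * e"
    "\<And>T. T \<in> set Ts \<Longrightarrow> sk_into q d T"
    using f[OF i] by (auto simp: tensor_rows_def)
  define A where "A = take e Ts"
  define B where "B = take e (drop e Ts)"
  define C where "C = drop e (drop e Ts)"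
  have ABC: "Ts = (A @ B) @ C" "length A = e" "length B = e" "length C = e"
    using Ts(2) unfolding A_def B_def C_def by (simp_all del: drop_drop)
  have "A \<noteq> []" using ABC(2) e by auto
  then have "sk_krons q d Ts = sk_kron k D (sk_kron k D (sk_krons q d A) (sk_krons q d B)) (sk_krons q d C)"
    using q ABC by (simp add: sk_krons_append k D del: append_assoc)
  moreover have "sk_into k D (sk_krons q d A)" "sk_into k D (sk_krons q d B)" "sk_into k D (sk_krons q d C)"
    using sk_into_krons[of A q d] sk_into_krons[of B q d] sk_into_krons[of C q d] Ts(3) ABC by (auto simp: k D)
  ultimately show "\<exists>T1 T2 T3 w. sk_into k D T1 \<and> sk_into k D T2 \<and> sk_into k D T3 \<and>
      (\<forall>j<k * k * k. row_matrix m (k * k * k) s f $$ (i, j)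
         = s * sk_row (sk_kron k D (sk_kron k D T1 T2) T3) w j)"
    using i Ts(1)
    by (intro exI[of _ "sk_krons q d A"] exI[of _ "sk_krons q d B"] exI[of _ "sk_krons q d C"] exI[of _ w])
       (simp add: row_matrix_def)
qed (simp add: row_matrix_def)

theorem theorem1p2:
  shows "\<exists>(c1::real) (c2::real) (\<kappa>::real) (Cm::real) (C2::real) (C3::real).
    0 < c1 \<and> c1 \<le> c2 \<and> 0 < \<kappa> \<and>
    (\<forall>(n::nat) (\<delta>::real). 1 \<le> n \<longrightarrow> 0 < \<delta> \<longrightarrow> \<delta> < 1 \<longrightarrow>
      (\<exists>(m::nat) (M :: real mat measure).
        linear_map_distribution m n M \<and>
        (2 \<le> n \<longrightarrow> real m \<le> Cm * (ln (real n) ^ 4 + ln (1 / \<delta>) ^ 2 * ln (real n))) \<and>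
        (\<forall>x\<in>carrier_vec n.
           measure M {S \<in> space M. l1_norm_vec (S *\<^sub>v x) \<le> c2 * l1_norm_vec x} \<ge> \<kappa> \<and>
           measure M {S \<in> space M. l1_norm_vec (S *\<^sub>v x) \<ge> c1 * l1_norm_vec x} \<ge> 1 - \<delta>) \<and>
        (\<forall>k::nat. n = k ^ 2 \<longrightarrow>
           (AE S in M. applies_to_rank_one2_within S k (C2 * (real m * real k)))) \<and>
        (\<forall>k::nat. n = k ^ 3 \<longrightarrow> 2 \<le> k \<longrightarrow>
           (AE S in M. applies_to_rank_one3_within S k
                         (C3 * (real m * real k * ln (real k) ^ 2))))))"
proof -
  \<comment> \<open>This bounds the loss for every admissible number \<open>L \<le> 6\<close> of
    factors, so that all constants are absolute.\<close>
  define c :: real where "c = (1 / 64) ^ 6"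
  define \<gamma> where "\<gamma> = c / 16"
  \<comment> \<open>Makes \<open>\<gamma> / 8 * u\<close> equal to \<open>ln (1 / \<delta>)\<close>,
    the exponent that \<open>average_lower\<close> has to supply.\<close>
  define A where "A = 8 / \<gamma>"
  define K :: nat where "K = 10 + 8 * 4096 ^ 3"
  have c0: "0 < c" and \<gamma>0: "0 < \<gamma>" and \<gamma>1: "\<gamma> / 8 \<le> 20" by (simp_all add: c_def \<gamma>_def power_divide)
  have A0: "0 < A" using \<gamma>0 by (simp add: A_def)
  have ln2: "0 < ln (2::real)" by simp
  show ?thesis
  proof (rule exI[of _ "\<gamma> / 8"], rule exI[of _ 20], rule exI[of _ "2 / 5"],
      rule exI[of _ "4 / ln 2 ^ 4 + 4 * A\<^sup>2 / ln 2"], rule exI[of _ "real K"],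
      rule exI[of _ "real K / ln 2 ^ 2"], intro conjI allI impI)
    fix n :: nat and \<delta> :: real
    assume n: "1 \<le> n" and \<delta>: "0 < \<delta>" "\<delta> < 1"
    define u where "u = A * ln (1 / \<delta>)"
    have u0: "0 \<le> u" using A0 \<delta> by (simp add: u_def)
    obtain g :: nat where gD: "0 < g" "u \<le> 2 ^ g" "4 ^ g \<le> 4 + 4 * u\<^sup>2"
      using ex_row_count[OF u0] by blast
    define m :: nat where "m = 4 ^ g"
    obtain q L where qL: "1 \<le> q" "q ^ L = n" "L \<le> 6"
      and order2: "\<forall>k. n = k ^ 2 \<longrightarrow> (\<exists>e. 1 \<le> e \<and> e \<le> 3 \<and> L = 2 * e \<and> k = q ^ e)"
      and order3: "\<forall>k. n = k ^ 3 \<longrightarrow> (\<exists>e. 1 \<le> e \<and> e \<le> 3 \<and> L = 3 * e \<and> k = q ^ e)"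
      by (rule ex_tensor_order[OF n])
    obtain d p where d: "l1_sketch q d (1 / 64) p" "d ^ 4 \<le> 4096 * q"
      by (rule ex_l1_sketch_fourth_root[OF qL(1)])
    define Q where "Q = map_pmf (sk_krons q d) (iid_list L p)"
    define D where "D = d ^ L"
    have "c \<le> (1 / 64) ^ L" unfolding c_def using qL(3) by (intro power_decreasing) auto
    then have Q: "l1_sketch n D c Q"
      using l1_sketch_weaken[OF l1_sketch_krons[OF d(1), of L]] qL(2) by (simp add: Q_def D_def)
    \<comment> \<open>\<open>J\<close> enters neither the number of rows nor the program length, so
      it may depend freely on \<open>n\<close> and \<open>g\<close>.\<close>
    obtain J :: nat where "2 * real D * 2 ^ g / c < 2 ^ J" using real_arch_pow[of 2] by auto
    then have J: "2 * real D * 2 ^ g \<le> c * 2 ^ J" using c0 by (simp add: field_simps)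
    define \<rho> where "\<rho> = random_row Q D J"
    define s where "s = 1 / (real m * g)"
    define M where "M = matrix_measure m n s \<rho>"
    have s0: "0 \<le> s" by (simp add: s_def)
    have rows: "f i \<in> tensor_rows q d L" if "f \<in> set_pmf (Pi_pmf {..<m} (\<lambda>_. 0) (\<lambda>_. \<rho>))" "i < m" for f i
      using that set_random_row_krons[OF d(1), of L D J] unfolding \<rho>_def Q_def
      by (auto simp: set_Pi_pmf PiE_dflt_def)
    show "\<exists>(m::nat) (M :: real mat measure).
        linear_map_distribution m n M \<and>
        (2 \<le> n \<longrightarrow> real m \<le> (4 / ln 2 ^ 4 + 4 * A\<^sup>2 / ln 2) * (ln (real n) ^ 4 + ln (1 / \<delta>) ^ 2 * ln (real n))) \<and>
        (\<forall>x\<in>carrier_vec n.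
           measure M {S \<in> space M. l1_norm_vec (S *\<^sub>v x) \<le> 20 * l1_norm_vec x} \<ge> 2 / 5 \<and>
           measure M {S \<in> space M. l1_norm_vec (S *\<^sub>v x) \<ge> \<gamma> / 8 * l1_norm_vec x} \<ge> 1 - \<delta>) \<and>
        (\<forall>k::nat. n = k ^ 2 \<longrightarrow>
           (AE S in M. applies_to_rank_one2_within S k (real K * (real m * real k)))) \<and>
        (\<forall>k::nat. n = k ^ 3 \<longrightarrow> 2 \<le> k \<longrightarrow>
           (AE S in M. applies_to_rank_one3_within S k
                         (real K / ln 2 ^ 2 * (real m * real k * ln (real k) ^ 2))))"
    proof (intro exI[of _ m] exI[of _ M] conjI ballI allI impI)
      show "linear_map_distribution m n M"
        unfolding M_def by (rule linear_map_distribution_matrix_measure)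
    next
      assume "2 \<le> n"
      then have ln: "ln 2 \<le> ln (real n)" by simp
      \<comment> \<open>The row count is bounded in terms of \<open>\<delta>\<close> alone; the
        logarithms of \<open>n\<close> are inserted through \<open>ln 2 \<le> ln n\<close>.\<close>
      have "real m \<le> 4 + 4 * A\<^sup>2 * ln (1 / \<delta>) ^ 2"
        using gD(3) by (simp add: m_def u_def power_mult_distrib mult.assoc)
      also have "\<dots> \<le> 4 / ln 2 ^ 4 * ln n ^ 4 + 4 * A\<^sup>2 / ln 2 * (ln (1 / \<delta>) ^ 2 * ln n)"
      proof (intro add_mono)
        have "ln 2 ^ 4 \<le> ln (real n) ^ 4" using ln ln2 by (intro power_mono) auto
        then show "4 \<le> 4 / ln 2 ^ 4 * ln (real n) ^ 4" using ln2 by (simp add: field_simps)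
        have "4 * A\<^sup>2 * ln (1 / \<delta>) ^ 2 * ln 2 \<le> 4 * A\<^sup>2 * ln (1 / \<delta>) ^ 2 * ln n"
          using ln by (intro mult_left_mono) auto
        then show "4 * A\<^sup>2 * ln (1 / \<delta>) ^ 2 \<le> 4 * A\<^sup>2 / ln 2 * (ln (1 / \<delta>) ^ 2 * ln n)"
          using ln2 by (simp add: field_simps)
      qed
      also have "\<dots> \<le> (4 / ln 2 ^ 4 + 4 * A\<^sup>2 / ln 2) * (ln n ^ 4 + ln (1 / \<delta>) ^ 2 * ln n)"
      proof -
        have ln_n: "0 \<le> ln (real n)" using ln ln2 by (rule order_trans[OF less_imp_le, rotated])
        have "0 \<le> 4 * A\<^sup>2 / ln 2 * ln (real n) ^ 4"
          "0 \<le> 4 / ln 2 ^ 4 * (ln (1 / \<delta>) ^ 2 * ln (real n))"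
          using ln_n ln2 by (simp_all only: zero_le_power2 zero_le_power mult_nonneg_nonneg
              divide_nonneg_nonneg less_imp_le zero_le_numeral)
        then show ?thesis unfolding distrib_left distrib_right by linarith
      qed
      finally show "real m \<le> \<dots>" .
    next
      fix x :: "real vec" assume x: "x \<in> carrier_vec n"
      let ?x = "\<lambda>j. x $ j"
      have norm_x: "l1_norm_vec x = l1 n ?x" using x by (simp add: l1_norm_vec_def l1_def)
      have norm: "l1_norm_vec (row_matrix m n s f *\<^sub>v x) = (\<Sum>i<4 ^ g. \<bar>\<Sum>j<n. f i j * x $ j\<bar>) / (real (4 ^ g) * g)" for f
        unfolding l1_norm_row_matrix[OF x s0] by (simp add: s_def m_def)
      have "2 / 5 \<le> measure M {S \<in> space M. l1_norm_vec (S *\<^sub>v x) \<le> 20 * l1_norm_vec x} \<and>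
           measure M {S \<in> space M. l1_norm_vec (S *\<^sub>v x) \<ge> \<gamma> / 8 * l1_norm_vec x} \<ge> 1 - \<delta>"
      proof (cases "l1 n ?x = 0")
        case True
        then have "x $ j = 0" if "j < n" for j
          using that by (simp add: l1_def sum_nonneg_eq_0_iff)
        then show ?thesis
          unfolding M_def prob_matrix_measure norm norm_x True using \<delta> by simp
      next
        case False
        then have X0: "0 < l1 n ?x" using l1_nonneg[of n ?x] by linarith
        interpret cauchy_like \<rho> "\<lambda>r. \<Sum>j<n. r j * x $ j" "l1 n ?x" \<gamma> g
          unfolding \<rho>_def \<gamma>_def by (rule cauchy_like_random_row[OF Q c0 X0 gD(1) J])
        have "ln (1 / \<delta>) = \<gamma> / 8 * u" using \<gamma>0 by (simp add: u_def A_def)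
        also have "\<dots> \<le> \<gamma> / 8 * g * 2 ^ g"
        proof -
          have "u \<le> g * 2 ^ g" using gD(1,2) by (intro order_trans[OF gD(2)]) simp
          then show ?thesis using \<gamma>0 by (simp add: mult.assoc mult_left_mono)
        qed
        finally have "- (\<gamma> / 8 * g * 2 ^ g) \<le> ln \<delta>" using \<delta> by (simp add: ln_div)
        then have "exp (- (\<gamma> / 8 * g * 2 ^ g)) \<le> \<delta>" using \<delta> by (metis exp_le_cancel_iff exp_ln)
        from average_lower[OF this, of "\<lambda>_. 0"] average_upper[of "\<lambda>_. 0"] show ?thesis
          unfolding M_def prob_matrix_measure norm norm_x unfolding m_def by simp
      qed
      then show "2 / 5 \<le> measure M {S \<in> space M. l1_norm_vec (S *\<^sub>v x) \<le> 20 * l1_norm_vec x}"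
        "measure M {S \<in> space M. l1_norm_vec (S *\<^sub>v x) \<ge> \<gamma> / 8 * l1_norm_vec x} \<ge> 1 - \<delta>" by auto
    next
      fix k assume k: "n = k ^ 2"
      then obtain e where e: "1 \<le> e" "e \<le> 3" "L = 2 * e" "k = q ^ e" using order2 by blast
      have n_eq: "n = k * k" using k by (simp add: power2_eq_square)
      show "AE S in M. applies_to_rank_one2_within S k (real K * (real m * real k))"
        unfolding M_def
      proof (rule AE_matrix_measureI)
        fix f assume f: "f \<in> set_pmf (Pi_pmf {..<m} (\<lambda>_. 0) (\<lambda>_. \<rho>))"
        have "applies_to_rank_one2_within (row_matrix m n s f) k
            (real (m * (6 * k + 2 * d ^ e + 4 * (d ^ e)\<^sup>2 + 1)))"
          unfolding n_eq using rows[OF f] e qL(1) by (intro tensor_rows_apply2) auto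
        moreover have "m * (6 * k + 2 * d ^ e + 4 * (d ^ e)\<^sup>2 + 1) \<le> m * (K * k)"
          unfolding K_def using program_length_bound(1)[OF d(2) e(4) refl e(1,2) qL(1)] by (intro mult_le_mono2)
        then have "real (m * (6 * k + 2 * d ^ e + 4 * (d ^ e)\<^sup>2 + 1)) \<le> real K * (real m * real k)"
          by (metis of_nat_mono of_nat_mult mult.left_commute)
        ultimately show "applies_to_rank_one2_within (row_matrix m n s f) k (real K * (real m * real k))"
          by (rule applies_to_rank_one_within_mono)
      qed
    next
      fix k :: nat assume k: "n = k ^ 3" "2 \<le> k"
      then obtain e where e: "1 \<le> e" "e \<le> 3" "L = 3 * e" "k = q ^ e" using order3 by blast
      have n_eq: "n = k * k * k" using k by (simp add: power3_eq_cube)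
      show "AE S in M. applies_to_rank_one3_within S k (real K / ln 2 ^ 2 * (real m * real k * ln (real k) ^ 2))"
        unfolding M_def
      proof (rule AE_matrix_measureI)
        fix f assume f: "f \<in> set_pmf (Pi_pmf {..<m} (\<lambda>_. 0) (\<lambda>_. \<rho>))"
        have "applies_to_rank_one3_within (row_matrix m n s f) k
            (real (m * (9 * k + 3 * d ^ e + (d ^ e)\<^sup>2 + 4 * (d ^ e) ^ 3 + 1)))"
          unfolding n_eq using rows[OF f] e qL(1) by (intro tensor_rows_apply3) auto
        moreover have "m * (9 * k + 3 * d ^ e + (d ^ e)\<^sup>2 + 4 * (d ^ e) ^ 3 + 1) \<le> m * (K * k)"
          unfolding K_def using program_length_bound(2)[OF d(2) e(4) refl e(1,2) qL(1)] by (intro mult_le_mono2)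
        then have "real (m * (9 * k + 3 * d ^ e + (d ^ e)\<^sup>2 + 4 * (d ^ e) ^ 3 + 1)) \<le> real K * (real m * real k)"
          by (metis of_nat_mono of_nat_mult mult.left_commute)
        \<comment> \<open>The program is already linear in \<open>m * k\<close>, so the squared
          logarithm only has to be bounded below; hence the division by
          \<open>ln 2 ^ 2\<close>.\<close>
        moreover have "real K * (real m * real k) \<le> real K / ln 2 ^ 2 * (real m * real k * ln (real k) ^ 2)"
        proof -
          have "ln 2 ^ 2 \<le> ln (real k) ^ 2" using k(2) ln2 by (intro power_mono) auto
          then have "real K * (real m * real k) * ln 2 ^ 2 \<le> real K * (real m * real k) * ln (real k) ^ 2"
            by (intro mult_left_mono) auto
          then show ?thesis using ln2 by (simp add: field_simps)
        qed
        ultimately show "applies_to_rank_one3_within (row_matrix m n s f) k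
            (real K / ln 2 ^ 2 * (real m * real k * ln (real k) ^ 2))"
          by (meson applies_to_rank_one_within_mono(2) order_trans)
      qed
    qed
  qed (use \<gamma>0 \<gamma>1 in auto)
qed

end
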